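(* Let $k$ be a field and let $A$ be an augmented ultrasolid $k$-algebra that is complete and profinite, with augmentation ideal $\mathfrak m$. Suppose that $M\in\mathrm{Solid}_A^\heartsuit$ is an $A$-module whose underlying ultrasolid $k$-module is profinite and that $\mathfrak m\otimes_A M=M$, i.e. the canonical map $\mathfrak m\otimes_A M\to M$ is an isomorphism. Then $M=0$.
   Context: $\mathrm{Pro}(\mathrm{Vect}_k^\omega)$ is the pro-completion of finite-dimensional $k$-vector spaces (its objects, called profinite vector spaces, have the form $\prod_I k$ with $\mathrm{Hom}(\prod_I k,k)=\bigoplus_I k$; it is equivalent to $\mathrm{Vect}_k^{op}$). For an uncountable strong limit cardinal $\sigma$, let $\mathrm{Pro}(\mathrm{Vect}_k^\omega)_{<\sigma}$ be the full subcategory of $\prod_I k$ with $|I|<\sigma$. The category $\mathrm{Solid}_k^\heartsuit$ of ultrasolid $k$-modules is the filtered colimit over $\sigma$ of the 1-categorical sifted cocompletions of $\mathrm{Pro}(\mathrm{Vect}_k^\omega)_{<\sigma}$; concretely, finite-product-preserving functors $\mathrm{Pro}(\mathrm{Vect}_k^\omega)^{op}\to\mathrm{Set}$ (automatically valued in $\mathrm{Vect}_k$ via the $k$-linear structure) that are left Kan extended from $\mathrm{Pro}(\mathrm{Vect}_k^\omega)_{<\sigma}^{op}$ for some $\sigma$. It is abelian with all small limits and colimits, contains profinite vector spaces via Yoneda (an ultrasolid module is called profinite if it lies in the essential image), and has a symmetric monoidal tensor product preserving colimits in each variable with $\prod_I k\otimes\prod_J k=\prod_{I\times J}k$. An ultrasolid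 $k$-algebra is a commutative algebra object of $\mathrm{Solid}_k^\heartsuit$; $\mathrm{Solid}_A^\heartsuit$ is the category of $A$-modules in $\mathrm{Solid}_k^\heartsuit$, with relative (underived) tensor product $\otimes_A$. An augmented ultrasolid $k$-algebra is one equipped with an algebra map $A\to k$; its augmentation ideal is $\mathfrak m=\ker(A\to k)$, and $\mathfrak m^n$ is the image of $\mathfrak m^{\otimes_A n}\to A$. It is complete if $A\to\varprojlim A/\mathfrak m^n$ is an isomorphism, and complete profinite if moreover its underlying ultrasolid $k$-module is profinite. *)

theory Defs
  imports "HOL-Library.Poly_Mapping"
begin

unbundle cardinal_syntax

section \<open>Profinite vector spaces\<close>

text \<open>
  The object \<open>\<Prod>\<^sub>I k\<close> is represented by its index set \<open>I\<close>.  A morphism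
  \<open>\<Prod>\<^sub>I k \<rightarrow> \<Prod>\<^sub>J k\<close> is a \<open>J\<close>-indexed family of elements of
  \<open>Hom(\<Prod>\<^sub>I k, k) = \<Oplus>\<^sub>I k\<close>, extended by zero outside \<open>J\<close>.

  The cutoff cardinal \<open>\<sigma>\<close> is the cardinality of a type \<open>'u\<close>: the category
  \<open>Pro(Vect)\<^bsub><\<sigma>\<^esub>\<close> has as objects the index sets \<open>I :: 'u set\<close> with \<open>|I| < \<sigma>\<close>.
  The category of ultrasolid modules is the filtered union over \<open>\<sigma>\<close> of the categories
  defined below, so any given finite collection of ultrasolid modules lives at one stage.
  Uncountable strong limit cardinals are cofinal among all infinite cardinals, hence letting \<open>\<sigma>\<close>
  range over all infinite cardinals gives the same union; statements are therefore made for an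
  arbitrary infinite type \<open>'u\<close>, which includes every stage with \<open>\<sigma>\<close> an uncountable strong limit.
\<close>

definition small :: "'u set \<Rightarrow> bool"
  where "small I \<longleftrightarrow> |I| <o |UNIV :: 'u set|"

type_synonym ('i, 'j, 'k) pmap = "'j \<Rightarrow> ('i \<Rightarrow>\<^sub>0 'k)"

definition pscale :: "'k::field \<Rightarrow> ('g \<Rightarrow>\<^sub>0 'k) \<Rightarrow> ('g \<Rightarrow>\<^sub>0 'k)"
  where "pscale c p = Poly_Mapping.map ((*) c) p"

definition phom :: "'i set \<Rightarrow> 'j set \<Rightarrow> ('i, 'j, 'k::field) pmap set"
  where "phom I J = {f. (\<forall>j\<in>J. Poly_Mapping.keys (f j) \<subseteq> I) \<and> (\<forall>j. j \<notin> J \<longrightarrow> f j = 0)}"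

text \<open>For \<open>I \<subseteq> J\<close>, \<open>pid I\<close> also serves as the inclusion \<open>\<Prod>\<^sub>I k \<rightarrow> \<Prod>\<^sub>J k\<close>
  (extension by zero).\<close>

definition pid :: "'i set \<Rightarrow> ('i, 'i, 'k::field) pmap"
  where "pid I = (\<lambda>i. if i \<in> I then Poly_Mapping.single i 1 else 0)"

definition pcomp :: "('j, 'l, 'k::field) pmap \<Rightarrow> ('i, 'j, 'k) pmap \<Rightarrow> ('i, 'l, 'k) pmap"
  where "pcomp g f = (\<lambda>l. \<Sum>j\<in>Poly_Mapping.keys (g l). pscale (Poly_Mapping.lookup (g l) j) (f j))"

text \<open>\<open>f \<otimes> g : \<Prod>\<^bsub>I\<times>I'\<^esub> k \<rightarrow> \<Prod>\<^bsub>J\<times>J'\<^esub> k\<close>, under \<open>\<Prod>\<^sub>I k \<otimes> \<Prod>\<^sub>J k = \<Prod>\<^bsub>I\<times>J\<^esub> k\<close>.\<close>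

definition ptens ::
  "('i, 'j, 'k::field) pmap \<Rightarrow> ('i2, 'j2, 'k) pmap \<Rightarrow> ('i \<times> 'i2, 'j \<times> 'j2, 'k) pmap"
  where "ptens f g = (\<lambda>(j, j2). \<Sum>i\<in>Poly_Mapping.keys (f j). \<Sum>i2\<in>Poly_Mapping.keys (g j2).
           Poly_Mapping.single (i, i2) (Poly_Mapping.lookup (f j) i * Poly_Mapping.lookup (g j2) i2))"


section \<open>Ultrasolid modules\<close>

text \<open>
  A presheaf on profinite vector spaces: \<open>sec F I\<close> is its set of sections on \<open>\<Prod>\<^sub>I k\<close>, and
  \<open>pull F I J f : sec F J \<rightarrow> sec F I\<close> is its value on \<open>f : \<Prod>\<^sub>I k \<rightarrow> \<Prod>\<^sub>J k\<close>.
  The remaining fields are the vector space structure on sections.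
\<close>

record (overloaded) ('k::zero, 'u, 'a) presheaf =
  sec :: "'u set \<Rightarrow> 'a set"
  pull :: "'u set \<Rightarrow> 'u set \<Rightarrow> ('u, 'u, 'k) pmap \<Rightarrow> 'a \<Rightarrow> 'a"
  vzero :: "'u set \<Rightarrow> 'a"
  vadd :: "'u set \<Rightarrow> 'a \<Rightarrow> 'a \<Rightarrow> 'a"
  vscale :: "'u set \<Rightarrow> 'k \<Rightarrow> 'a \<Rightarrow> 'a"

text \<open>
  Finite products in the opposite category of profinite vector spaces are the finite coproducts
  \<open>0 = \<Prod>\<^bsub>{}\<^esub> k\<close> and \<open>\<Prod>\<^bsub>I\<union>J\<^esub> k\<close> with \<open>I\<close> and \<open>J\<close> disjoint.  The last three conditions express that
  the linear structure on sections is the one induced by that of the morphisms: since every pair of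
  sections over \<open>I\<close> has the form \<open>(f\<^sup>* x, g\<^sup>* x)\<close>, they determine it uniquely and imply the vector space
  axioms.
\<close>

definition ultrasolid :: "('k::field, 'u, 'a, 'z) presheaf_scheme \<Rightarrow> bool"
  where "ultrasolid F \<longleftrightarrow>
    (\<forall>I J f x. small I \<and> small J \<and> f \<in> phom I J \<and> x \<in> sec F J \<longrightarrow> pull F I J f x \<in> sec F I) \<and>
    (\<forall>I x. small I \<and> x \<in> sec F I \<longrightarrow> pull F I I (pid I) x = x) \<and>
    (\<forall>I J L f g x. small I \<and> small J \<and> small L \<and> f \<in> phom I J \<and> g \<in> phom J L \<and> x \<in> sec F L \<longrightarrow>
       pull F I L (pcomp g f) x = pull F I J f (pull F J L g x)) \<and>
    (\<exists>!x. x \<in> sec F {}) \<and>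
    (\<forall>I J. small I \<and> small J \<and> I \<inter> J = {} \<longrightarrow>
       bij_betw (\<lambda>x. (pull F I (I \<union> J) (pid I) x, pull F J (I \<union> J) (pid J) x))
         (sec F (I \<union> J)) (sec F I \<times> sec F J)) \<and>
    (\<forall>I J x. small I \<and> small J \<and> x \<in> sec F J \<longrightarrow> pull F I J (\<lambda>_. 0) x = vzero F I) \<and>
    (\<forall>I J f g x. small I \<and> small J \<and> f \<in> phom I J \<and> g \<in> phom I J \<and> x \<in> sec F J \<longrightarrow>
       pull F I J (\<lambda>j. f j + g j) x = vadd F I (pull F I J f x) (pull F I J g x)) \<and>
    (\<forall>I J c f x. small I \<and> small J \<and> f \<in> phom I J \<and> x \<in> sec F J \<longrightarrow>
       pull F I J (\<lambda>j. pscale c (f j)) x = vscale F I c (pull F I J f x))"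

definition morphism ::
  "('k::field, 'u, 'a, 'y) presheaf_scheme \<Rightarrow> ('k, 'u, 'b, 'z) presheaf_scheme \<Rightarrow>
   ('u set \<Rightarrow> 'a \<Rightarrow> 'b) \<Rightarrow> bool"
  where "morphism F G h \<longleftrightarrow>
    (\<forall>I x. small I \<and> x \<in> sec F I \<longrightarrow> h I x \<in> sec G I) \<and>
    (\<forall>I J f x. small I \<and> small J \<and> f \<in> phom I J \<and> x \<in> sec F J \<longrightarrow>
       h I (pull F I J f x) = pull G I J f (h J x))"

definition isomorphism ::
  "('k::field, 'u, 'a, 'y) presheaf_scheme \<Rightarrow> ('k, 'u, 'b, 'z) presheaf_scheme \<Rightarrow>
   ('u set \<Rightarrow> 'a \<Rightarrow> 'b) \<Rightarrow> bool"
  where "isomorphism F G h \<longleftrightarrow>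
    morphism F G h \<and> (\<forall>I. small I \<longrightarrow> bij_betw (h I) (sec F I) (sec G I))"

definition is_zero :: "('k::field, 'u, 'a, 'z) presheaf_scheme \<Rightarrow> bool"
  where "is_zero F \<longleftrightarrow> (\<forall>I. small I \<longrightarrow> sec F I = {vzero F I})"

definition yoneda :: "'p set \<Rightarrow> ('k::field, 'u, ('u, 'p, 'k) pmap) presheaf"
  where "yoneda P = \<lparr>
    sec = (\<lambda>I. phom I P),
    pull = (\<lambda>I J f x. pcomp x f),
    vzero = (\<lambda>I p. 0),
    vadd = (\<lambda>I x y p. x p + y p),
    vscale = (\<lambda>I c x p. pscale c (x p))\<rparr>"

definition profinite :: "('k::field, 'u, 'a, 'z) presheaf_scheme \<Rightarrow> bool"
  where "profinite F \<longleftrightarrow> (\<exists>(P :: 'u set) h. small P \<and> isomorphism (yoneda P) F h)"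

text \<open>The unit object \<open>k\<close>, as the profinite vector space on a one-element index set.\<close>

abbreviation kunit :: "('k::field, 'u, ('u, unit, 'k) pmap) presheaf"
  where "kunit \<equiv> yoneda UNIV"

inductive_set lspan :: "('k::field, 'u, 'a, 'z) presheaf_scheme \<Rightarrow> 'u set \<Rightarrow> 'a set \<Rightarrow> 'a set"
  for F I S where
    zero: "vzero F I \<in> lspan F I S"
  | base: "x \<in> S \<Longrightarrow> x \<in> lspan F I S"
  | add: "x \<in> lspan F I S \<Longrightarrow> y \<in> lspan F I S \<Longrightarrow> vadd F I x y \<in> lspan F I S"
  | scale: "x \<in> lspan F I S \<Longrightarrow> vscale F I c x \<in> lspan F I S"

text \<open>Quotient by a subfunctor \<open>N\<close>; cokernels of ultrasolid modules are computed sectionwise.\<close>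

definition coset ::
  "('k::field, 'u, 'a, 'z) presheaf_scheme \<Rightarrow> ('u set \<Rightarrow> 'a set) \<Rightarrow> 'u set \<Rightarrow> 'a \<Rightarrow> 'a set"
  where "coset F N I x = {vadd F I x n | n. n \<in> N I}"

definition quot ::
  "('k::field, 'u, 'a, 'z) presheaf_scheme \<Rightarrow> ('u set \<Rightarrow> 'a set) \<Rightarrow> ('k, 'u, 'a set) presheaf"
  where "quot F N = \<lparr>
    sec = (\<lambda>I. coset F N I ` sec F I),
    pull = (\<lambda>I J f X. \<Union>x\<in>X. coset F N I (pull F I J f x)),
    vzero = (\<lambda>I. coset F N I (vzero F I)),
    vadd = (\<lambda>I X Y. \<Union>x\<in>X. \<Union>y\<in>Y. coset F N I (vadd F I x y)),
    vscale = (\<lambda>I c X. \<Union>x\<in>X. coset F N I (vscale F I c x))\<rparr>"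


section \<open>Tensor product\<close>

text \<open>
  The tensor product is Day convolution, the extension of
  \<open>\<Prod>\<^sub>I k \<otimes> \<Prod>\<^sub>J k = \<Prod>\<^bsub>I\<times>J\<^esub> k\<close> that preserves colimits in each variable: \<open>(F \<otimes> G)(K)\<close> is the
  \<open>k\<close>-linear coend over \<open>I\<close>, \<open>J\<close> of
  \<open>Hom(\<Prod>\<^sub>K k, \<Prod>\<^bsub>I\<times>J\<^esub> k) \<otimes> F(I) \<otimes> G(J)\<close>, presented here by generators
  \<open>(I, J, \<phi>, x, y)\<close> and relations.  The index set \<open>I \<times> J\<close> only occurs as the
  target of \<open>\<phi>\<close> and need not be coded as a subset of \<open>'u\<close>.
\<close>

type_synonym ('k, 'u, 'a, 'b) tgen = "'u set \<times> 'u set \<times> ('u, 'u \<times> 'u, 'k) pmap \<times> 'a \<times> 'b"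

type_synonym ('k, 'u, 'a, 'b) tensor = "(('k, 'u, 'a, 'b) tgen \<Rightarrow>\<^sub>0 'k) set"

definition tgens ::
  "('k::field, 'u, 'a, 'y) presheaf_scheme \<Rightarrow> ('k, 'u, 'b, 'z) presheaf_scheme \<Rightarrow> 'u set \<Rightarrow>
   ('k, 'u, 'a, 'b) tgen set"
  where "tgens F G K = {(I, J, \<phi>, x, y).
    small I \<and> small J \<and> \<phi> \<in> phom K (I \<times> J) \<and> x \<in> sec F I \<and> y \<in> sec G J}"

definition tfree ::
  "('k::field, 'u, 'a, 'y) presheaf_scheme \<Rightarrow> ('k, 'u, 'b, 'z) presheaf_scheme \<Rightarrow>
   ('k, 'u, ('k, 'u, 'a, 'b) tgen \<Rightarrow>\<^sub>0 'k) presheaf"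
  where "tfree F G = \<lparr>
    sec = (\<lambda>K. {p. Poly_Mapping.keys p \<subseteq> tgens F G K}),
    pull = (\<lambda>K L f p. \<Sum>(I, J, \<phi>, x, y)\<in>Poly_Mapping.keys p.
      Poly_Mapping.single (I, J, pcomp \<phi> f, x, y) (Poly_Mapping.lookup p (I, J, \<phi>, x, y))),
    vzero = (\<lambda>K. 0),
    vadd = (\<lambda>K p q. p + q),
    vscale = (\<lambda>K c p. pscale c p)\<rparr>"

abbreviation gen :: "'g \<Rightarrow> ('g \<Rightarrow>\<^sub>0 'k::field)"
  where "gen g \<equiv> Poly_Mapping.single g 1"

inductive_set trels ::
  "('k::field, 'u, 'a, 'y) presheaf_scheme \<Rightarrow> ('k, 'u, 'b, 'z) presheaf_scheme \<Rightarrow> 'u set \<Rightarrow>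
   (('k, 'u, 'a, 'b) tgen \<Rightarrow>\<^sub>0 'k) set"
  for F G K where
    add_hom: "(I, J, \<phi>, x, y) \<in> tgens F G K \<Longrightarrow> (I, J, \<psi>, x, y) \<in> tgens F G K \<Longrightarrow>
      gen (I, J, (\<lambda>j. \<phi> j + \<psi> j), x, y) - gen (I, J, \<phi>, x, y) - gen (I, J, \<psi>, x, y) \<in> trels F G K"
  | scale_hom: "(I, J, \<phi>, x, y) \<in> tgens F G K \<Longrightarrow>
      gen (I, J, (\<lambda>j. pscale c (\<phi> j)), x, y) - pscale c (gen (I, J, \<phi>, x, y)) \<in> trels F G K"
  | add_left: "(I, J, \<phi>, x, y) \<in> tgens F G K \<Longrightarrow> (I, J, \<phi>, x', y) \<in> tgens F G K \<Longrightarrow>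
      gen (I, J, \<phi>, vadd F I x x', y) - gen (I, J, \<phi>, x, y) - gen (I, J, \<phi>, x', y) \<in> trels F G K"
  | scale_left: "(I, J, \<phi>, x, y) \<in> tgens F G K \<Longrightarrow>
      gen (I, J, \<phi>, vscale F I c x, y) - pscale c (gen (I, J, \<phi>, x, y)) \<in> trels F G K"
  | add_right: "(I, J, \<phi>, x, y) \<in> tgens F G K \<Longrightarrow> (I, J, \<phi>, x, y') \<in> tgens F G K \<Longrightarrow>
      gen (I, J, \<phi>, x, vadd G J y y') - gen (I, J, \<phi>, x, y) - gen (I, J, \<phi>, x, y') \<in> trels F G K"
  | scale_right: "(I, J, \<phi>, x, y) \<in> tgens F G K \<Longrightarrow>
      gen (I, J, \<phi>, x, vscale G J c y) - pscale c (gen (I, J, \<phi>, x, y)) \<in> trels F G K"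
  | dinatural: "small I \<Longrightarrow> small J \<Longrightarrow> small I' \<Longrightarrow> small J' \<Longrightarrow>
      \<phi> \<in> phom K (I \<times> J) \<Longrightarrow> f \<in> phom I I' \<Longrightarrow> g \<in> phom J J' \<Longrightarrow> x \<in> sec F I' \<Longrightarrow> y \<in> sec G J' \<Longrightarrow>
      gen (I, J, \<phi>, pull F I I' f x, pull G J J' g y) - gen (I', J', pcomp (ptens f g) \<phi>, x, y)
        \<in> trels F G K"

definition tensor ::
  "('k::field, 'u, 'a, 'y) presheaf_scheme \<Rightarrow> ('k, 'u, 'b, 'z) presheaf_scheme \<Rightarrow>
   ('k, 'u, ('k, 'u, 'a, 'b) tensor) presheaf"
  where "tensor F G = quot (tfree F G) (\<lambda>K. lspan (tfree F G) K (trels F G K))"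

text \<open>\<open>ten F G K I J \<phi> x y\<close> is the pullback along \<open>\<phi> : \<Prod>\<^sub>K k \<rightarrow> \<Prod>\<^bsub>I\<times>J\<^esub> k\<close> of the
  external product of \<open>x \<in> F(I)\<close> and \<open>y \<in> G(J)\<close>; these elements span \<open>(F \<otimes> G)(K)\<close>.\<close>

definition ten ::
  "('k::field, 'u, 'a, 'y) presheaf_scheme \<Rightarrow> ('k, 'u, 'b, 'z) presheaf_scheme \<Rightarrow> 'u set \<Rightarrow>
   'u set \<Rightarrow> 'u set \<Rightarrow> ('u, 'u \<times> 'u, 'k) pmap \<Rightarrow> 'a \<Rightarrow> 'b \<Rightarrow> ('k, 'u, 'a, 'b) tensor"
  where "ten F G K I J \<phi> x y =
    coset (tfree F G) (\<lambda>K. lspan (tfree F G) K (trels F G K)) K (gen (I, J, \<phi>, x, y))"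

text \<open>For submodules of \<open>F'\<close> and \<open>G'\<close>, the map from their tensor product into \<open>F' \<otimes> G'\<close>
  induced by the inclusions: the class of \<open>p\<close> goes to the class of the same \<open>p\<close> modulo the larger
  set of relations.\<close>

definition tensor_incl ::
  "('k::field, 'u, 'a, 'y) presheaf_scheme \<Rightarrow> ('k, 'u, 'b, 'z) presheaf_scheme \<Rightarrow> 'u set \<Rightarrow>
   ('k, 'u, 'a, 'b) tensor \<Rightarrow> ('k, 'u, 'a, 'b) tensor"
  where "tensor_incl F' G' K X =
    (\<Union>p\<in>X. coset (tfree F' G') (\<lambda>K. lspan (tfree F' G') K (trels F' G' K)) K p)"

text \<open>
  The maps \<open>K \<rightarrow> (I\<^sub>1 \<times> I\<^sub>2) \<times> I\<^sub>3\<close> and \<open>K \<rightarrow> I\<^sub>1 \<times> (I\<^sub>2 \<times> I\<^sub>3)\<close> used to form the elements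
  \<open>(x \<otimes> y) \<otimes> z\<close> of \<open>(F \<otimes> G) \<otimes> H\<close> and \<open>x \<otimes> (y \<otimes> z)\<close> of \<open>F \<otimes> (G \<otimes> H)\<close> over \<open>K\<close> agree up to
  the associativity of the product of index sets, that is, the associator maps the first element to
  the second.  Here \<open>x \<otimes> y\<close> is formed over \<open>L\<close> and \<open>y \<otimes> z\<close> over \<open>L'\<close>.
\<close>

definition assoc_data ::
  "'u set \<Rightarrow> 'u set \<Rightarrow> 'u set \<Rightarrow> 'u set \<Rightarrow> ('u, 'u \<times> 'u, 'k::field) pmap \<Rightarrow> ('u, 'u \<times> 'u, 'k) pmap \<Rightarrow>
   'u set \<Rightarrow> ('u, 'u \<times> 'u, 'k) pmap \<Rightarrow> ('u, 'u \<times> 'u, 'k) pmap \<Rightarrow> 'u set \<Rightarrow> bool"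
  where "assoc_data K I1 I2 I3 \<phi> \<psi> L \<phi>' \<psi>' L' \<longleftrightarrow>
    small K \<and> small I1 \<and> small I2 \<and> small I3 \<and> small L \<and> small L' \<and>
    \<phi> \<in> phom K (L \<times> I3) \<and> \<psi> \<in> phom L (I1 \<times> I2) \<and>
    \<phi>' \<in> phom K (I1 \<times> L') \<and> \<psi>' \<in> phom L' (I2 \<times> I3) \<and>
    (\<forall>i1 i2 i3. pcomp (ptens \<psi> (pid I3)) \<phi> ((i1, i2), i3) =
                pcomp (ptens (pid I1) \<psi>') \<phi>' (i1, (i2, i3)))"


section \<open>Algebras and modules\<close>

text \<open>
  Structure maps are morphisms out of the tensor product; the axioms are stated on the generators
  \<open>ten\<close> of the tensor products, through the associator, the symmetry
  \<open>ten I J \<phi> x y \<mapsto> ten J I (swap \<phi>) y x\<close>, and the unitor \<open>k \<otimes> F \<rightarrow> F\<close>, which sends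
  \<open>ten K I J \<phi> a x\<close> to the pullback of \<open>x\<close> along \<open>(a \<otimes> id) \<circ> \<phi> : \<Prod>\<^sub>K k \<rightarrow> \<Prod>\<^sub>J k\<close>.
\<close>

record (overloaded) ('k::zero, 'u, 'a) alg = "('k, 'u, 'a) presheaf" +
  mult :: "'u set \<Rightarrow> ('k, 'u, 'a, 'a) tensor \<Rightarrow> 'a"
  unit_map :: "'u set \<Rightarrow> ('u, unit, 'k) pmap \<Rightarrow> 'a"

record (overloaded) ('k::zero, 'u, 'm, 'a) amod = "('k, 'u, 'm) presheaf" +
  act :: "'u set \<Rightarrow> ('k, 'u, 'a, 'm) tensor \<Rightarrow> 'm"

definition ultrasolid_algebra :: "('k::field, 'u, 'a) alg \<Rightarrow> bool"
  where "ultrasolid_algebra A \<longleftrightarrow>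
    ultrasolid A \<and> morphism (tensor A A) A (mult A) \<and> morphism kunit A (unit_map A) \<and>
    (\<forall>K I1 I2 I3 \<phi> \<psi> L \<phi>' \<psi>' L' x y z.
       assoc_data K I1 I2 I3 \<phi> \<psi> L \<phi>' \<psi>' L' \<and> x \<in> sec A I1 \<and> y \<in> sec A I2 \<and> z \<in> sec A I3 \<longrightarrow>
       mult A K (ten A A K L I3 \<phi> (mult A L (ten A A L I1 I2 \<psi> x y)) z) =
       mult A K (ten A A K I1 L' \<phi>' x (mult A L' (ten A A L' I2 I3 \<psi>' y z)))) \<and>
    (\<forall>K I J \<phi> x y. small K \<and> (I, J, \<phi>, x, y) \<in> tgens A A K \<longrightarrow>
       mult A K (ten A A K I J \<phi> x y) = mult A K (ten A A K J I (\<lambda>(j, i). \<phi> (i, j)) y x)) \<and>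
    (\<forall>K I J \<phi> a x. small K \<and> (I, J, \<phi>, a, x) \<in> tgens kunit A K \<longrightarrow>
       mult A K (ten A A K I J \<phi> (unit_map A I a) x) =
       pull A K J (\<lambda>j. pcomp (ptens a (pid J)) \<phi> ((), j)) x)"

definition ultrasolid_module :: "('k::field, 'u, 'a) alg \<Rightarrow> ('k, 'u, 'm, 'a) amod \<Rightarrow> bool"
  where "ultrasolid_module A M \<longleftrightarrow>
    ultrasolid M \<and> morphism (tensor A M) M (act M) \<and>
    (\<forall>K I1 I2 I3 \<phi> \<psi> L \<phi>' \<psi>' L' x y z.
       assoc_data K I1 I2 I3 \<phi> \<psi> L \<phi>' \<psi>' L' \<and> x \<in> sec A I1 \<and> y \<in> sec A I2 \<and> z \<in> sec M I3 \<longrightarrow>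
       act M K (ten A M K L I3 \<phi> (mult A L (ten A A L I1 I2 \<psi> x y)) z) =
       act M K (ten A M K I1 L' \<phi>' x (act M L' (ten A M L' I2 I3 \<psi>' y z)))) \<and>
    (\<forall>K I J \<phi> a x. small K \<and> (I, J, \<phi>, a, x) \<in> tgens kunit M K \<longrightarrow>
       act M K (ten A M K I J \<phi> (unit_map A I a) x) =
       pull M K J (\<lambda>j. pcomp (ptens a (pid J)) \<phi> ((), j)) x)"

text \<open>An augmentation is an algebra map to \<open>k\<close>, whose multiplication is the unitor \<open>k \<otimes> k = k\<close>.\<close>

definition augmentation ::
  "('k::field, 'u, 'a) alg \<Rightarrow> ('u set \<Rightarrow> 'a \<Rightarrow> ('u, unit, 'k) pmap) \<Rightarrow> bool"
  where "augmentation A \<epsilon> \<longleftrightarrow>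
    morphism A kunit \<epsilon> \<and>
    (\<forall>I a. small I \<and> a \<in> sec kunit I \<longrightarrow> \<epsilon> I (unit_map A I a) = a) \<and>
    (\<forall>K I J \<phi> x y. small K \<and> (I, J, \<phi>, x, y) \<in> tgens A A K \<longrightarrow>
       \<epsilon> K (mult A K (ten A A K I J \<phi> x y)) =
       (\<lambda>_. pcomp (ptens (\<epsilon> I x) (\<epsilon> J y)) \<phi> ((), ())))"

definition aug_ideal ::
  "('k::field, 'u, 'a) alg \<Rightarrow> ('u set \<Rightarrow> 'a \<Rightarrow> ('u, unit, 'k) pmap) \<Rightarrow> 'u set \<Rightarrow> 'a set"
  where "aug_ideal A \<epsilon> I = {x \<in> sec A I. \<epsilon> I x = vzero kunit I}"

text \<open>An ideal of \<open>A\<close>, given by its sections, as an \<open>A\<close>-module.\<close>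

definition ideal_module ::
  "('k::field, 'u, 'a) alg \<Rightarrow> ('u set \<Rightarrow> 'a set) \<Rightarrow> ('k, 'u, 'a, 'a) amod"
  where "ideal_module A S = \<lparr>
    sec = S, pull = pull A, vzero = vzero A, vadd = vadd A, vscale = vscale A,
    act = (\<lambda>K t. mult A K (tensor_incl A A K t))\<rparr>"

text \<open>
  \<open>N \<otimes>\<^sub>A M\<close> is the coequalizer of \<open>N \<otimes> A \<otimes> M \<rightrightarrows> N \<otimes> M\<close>.  The right action of \<open>A\<close> on \<open>N\<close>
  is the left action precomposed with the symmetry.
\<close>

definition balancing ::
  "('k::field, 'u, 'a) alg \<Rightarrow> ('k, 'u, 'n, 'a) amod \<Rightarrow> ('k, 'u, 'm, 'a) amod \<Rightarrow> 'u set \<Rightarrow>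
   ('k, 'u, 'n, 'm) tensor set"
  where "balancing A N M K =
    {vadd (tensor N M) K
       (ten N M K L I3 \<phi> (act N L (ten A N L I2 I1 (\<lambda>(i2, i1). \<psi> (i1, i2)) a x)) z)
       (vscale (tensor N M) K (-1)
         (ten N M K I1 L' \<phi>' x (act M L' (ten A M L' I2 I3 \<psi>' a z)))) |
     I1 I2 I3 \<phi> \<psi> L \<phi>' \<psi>' L' x a z.
     assoc_data K I1 I2 I3 \<phi> \<psi> L \<phi>' \<psi>' L' \<and> x \<in> sec N I1 \<and> a \<in> sec A I2 \<and> z \<in> sec M I3}"

definition rel_tensor ::
  "('k::field, 'u, 'a) alg \<Rightarrow> ('k, 'u, 'n, 'a) amod \<Rightarrow> ('k, 'u, 'm, 'a) amod \<Rightarrow>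
   ('k, 'u, ('k, 'u, 'n, 'm) tensor set) presheaf"
  where "rel_tensor A N M =
    quot (tensor N M) (\<lambda>K. lspan (tensor N M) K (balancing A N M K))"

text \<open>The canonical map \<open>S \<otimes>\<^sub>A M \<rightarrow> M\<close> for an ideal \<open>S\<close> of \<open>A\<close>, induced by
  \<open>S \<otimes> M \<rightarrow> A \<otimes> M \<rightarrow> M\<close>; the latter is constant on the classes that make up \<open>S \<otimes>\<^sub>A M\<close>.\<close>

definition canonical_map ::
  "('k::field, 'u, 'a) alg \<Rightarrow> ('k, 'u, 'm, 'a) amod \<Rightarrow> 'u set \<Rightarrow>
   ('k, 'u, 'a, 'm) tensor set \<Rightarrow> 'm"
  where "canonical_map A M K X = the_elem ((\<lambda>t. act M K (tensor_incl A M K t)) ` X)"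

text \<open>
  \<open>\<mm>\<^sup>n\<^sup>+\<^sup>1\<close> is the image of \<open>\<mm> \<otimes>\<^sub>A \<mm>\<^sup>n \<rightarrow> A\<close>.  By right exactness of \<open>\<otimes>\<^sub>A\<close> this is the image of the
  iterated tensor power \<open>\<mm> \<otimes>\<^sub>A (\<mm> \<otimes>\<^sub>A \<dots>) \<rightarrow> A\<close>, which, having sections in a type depending on
  \<open>n\<close>, cannot itself be written as a function of \<open>n\<close>.
\<close>

primrec ideal_power ::
  "('k::field, 'u, 'a) alg \<Rightarrow> ('u set \<Rightarrow> 'a set) \<Rightarrow> nat \<Rightarrow> 'u set \<Rightarrow> 'a set"
  where
    "ideal_power A S 0 = sec A"
  | "ideal_power A S (Suc n) = (\<lambda>K.
       canonical_map A (ideal_module A (ideal_power A S n)) K `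
         sec (rel_tensor A (ideal_module A S) (ideal_module A (ideal_power A S n))) K)"

text \<open>The limit of \<open>\<dots> \<rightarrow> A/N\<^sub>2 \<rightarrow> A/N\<^sub>1 \<rightarrow> A/N\<^sub>0\<close> for a decreasing sequence \<open>N\<close> of submodules;
  limits are computed sectionwise.\<close>

definition quot_limit ::
  "('k::field, 'u, 'a, 'z) presheaf_scheme \<Rightarrow> (nat \<Rightarrow> 'u set \<Rightarrow> 'a set) \<Rightarrow>
   ('k, 'u, nat \<Rightarrow> 'a set) presheaf"
  where "quot_limit F N = \<lparr>
    sec = (\<lambda>I. {X. \<forall>n. X n \<in> sec (quot F (N n)) I \<and>
                       (\<Union>x\<in>X (Suc n). coset F (N n) I x) = X n}),
    pull = (\<lambda>I J f X n. pull (quot F (N n)) I J f (X n)),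
    vzero = (\<lambda>I n. vzero (quot F (N n)) I),
    vadd = (\<lambda>I X Y n. vadd (quot F (N n)) I (X n) (Y n)),
    vscale = (\<lambda>I c X n. vscale (quot F (N n)) I c (X n))\<rparr>"

definition complete ::
  "('k::field, 'u, 'a) alg \<Rightarrow> ('u set \<Rightarrow> 'a \<Rightarrow> ('u, unit, 'k) pmap) \<Rightarrow> bool"
  where "complete A \<epsilon> \<longleftrightarrow>
    isomorphism A (quot_limit A (ideal_power A (aug_ideal A \<epsilon>)))
      (\<lambda>I x n. coset A (ideal_power A (aug_ideal A \<epsilon>) n) I x)"

end

theory Submission
  imports Defs
begin

text \<open>
  Why the theorem holds.  Choose coordinates in which \<open>A\<close> is \<open>\<Prod>\<^sub>Q k\<close> and \<open>M\<close> is \<open>\<Prod>\<^sub>P k\<close>.  A section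
  over \<open>I\<close> is then a family of finitely supported vectors in \<open>\<Oplus>\<^sub>I k\<close>, and every section is a
  pullback of the universal one, the identity.  Hence every tensor in \<open>A \<otimes> M\<close> is a pure
  tensor of the two universal sections (\<open>tclass_eq_uten\<close>), and the action of \<open>A\<close> on \<open>M\<close> is given by a
  matrix with finitely supported rows (\<open>structure_matrix\<close>).  This finiteness is the continuity of
  the action: a fixed coordinate of \<open>x \<cdot> y\<close> involves only finitely many coordinates of \<open>x\<close>.

  Let \<open>u\<close> be the universal section of \<open>M\<close>.  That \<open>\<mm> \<otimes>\<^sub>A M \<rightarrow> M\<close> is onto gives \<open>u = v \<cdot> u\<close>, formed along
  some \<open>\<phi> : \<Prod>\<^sub>P k \<rightarrow> \<Prod>\<^bsub>Q\<times>P\<^esub> k\<close>, with \<open>v\<close> in \<open>\<mm>\<close> (\<open>universal_section_fixed\<close>).  Substituting this equation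
  into itself and using associativity gives \<open>u = x \<cdot> u\<close> with \<open>x\<close> in \<open>\<mm>\<^sup>n\<close>, for every \<open>n\<close>
  (\<open>universal_section_in_mpow\<close>).  Completeness of \<open>A\<close> makes every coordinate vanish on \<open>\<mm>\<^sup>n\<close> once \<open>n\<close> is
  large (\<open>mpow_coordinates_vanish\<close>), so each coordinate of \<open>u\<close> is zero.  But \<open>u\<close> is the identity of
  \<open>\<Prod>\<^sub>P k\<close>, so \<open>P\<close> is empty and \<open>M = 0\<close>.

  In dual terms \<open>A\<close> is the dual of a coalgebra, which completeness makes conilpotent, and a
  nonzero comodule over such a coalgebra has nonzero coinvariants, whereas for the comodule dual to
  \<open>M\<close> the surjectivity of \<open>\<mm> \<otimes>\<^sub>A M \<rightarrow> M\<close> says that there are none.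

  The vanishing of coordinates is where completeness enters.  Suppose that the coordinate \<open>q\<close> is
  nonzero at some \<open>x\<^sub>n\<close> in \<open>\<mm>\<^sup>n\<close> for each \<open>n\<close>; one may take \<open>x\<^sub>n\<close> over a point.  If there is an infinite
  small index set, place the \<open>x\<^sub>n\<close> at distinct elements \<open>k\<^sub>n\<close> of a countable one, \<open>K\<close>.  The partial
  sums are compatible modulo the powers of \<open>\<mm>\<close>, so they have a limit \<open>z\<close> in \<open>A(K)\<close>, and its restriction
  to \<open>k\<^sub>n\<close> is \<open>x\<^sub>n\<close> because \<open>A\<close> is separated.  So the coordinate \<open>q\<close> of \<open>z\<close> has every \<open>k\<^sub>n\<close> in its
  support, although the support is finite.  If all small index sets are finite, then \<open>A\<close> is
  finite-dimensional, and the powers of \<open>\<mm>\<close> form a decreasing sequence of subspaces with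
  intersection zero, which reaches zero.
\<close>


section \<open>Linear combinations\<close>

text \<open>
  Composition and tensor product of morphisms, pullback of formal sums, and coordinates of tensors
  are all of the form \<open>\<Sum>\<^sub>q c\<^sub>q x\<^sub>q\<close> with \<open>c\<close> finitely supported, so their algebra is done once, here.
\<close>

definition lincomb :: "('a \<Rightarrow>\<^sub>0 'k::field) \<Rightarrow> ('a \<Rightarrow> ('b \<Rightarrow>\<^sub>0 'k)) \<Rightarrow> ('b \<Rightarrow>\<^sub>0 'k)"
  where "lincomb c x = (\<Sum>q\<in>Poly_Mapping.keys c. pscale (Poly_Mapping.lookup c q) (x q))"

lemma lookup_pscale [simp]: "Poly_Mapping.lookup (pscale c p) i = c * Poly_Mapping.lookup p i"
  unfolding pscale_def by (transfer) (auto simp: when_def)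

lemma pscale_add: "pscale c (p + q) = pscale c p + pscale c q"
  by (rule poly_mapping_eqI) (simp add: lookup_add algebra_simps)

lemma pscale_add_left: "pscale (c + d) p = pscale c p + pscale d p"
  by (rule poly_mapping_eqI) (simp add: lookup_add algebra_simps)

lemma pscale_pscale [simp]: "pscale c (pscale d p) = pscale (c * d) p"
  by (rule poly_mapping_eqI) (simp add: algebra_simps)

lemma pscale_zero [simp]: "pscale c 0 = 0" "pscale 0 p = 0"
  by (rule poly_mapping_eqI, simp)+

lemma pscale_one [simp]: "pscale 1 p = p"
  by (rule poly_mapping_eqI) simp

lemma pscale_minus_one: "pscale (- 1) p = - p"
  by (rule poly_mapping_eqI) simp

lemma pscale_sum: "pscale c (\<Sum>i\<in>S. f i) = (\<Sum>i\<in>S. pscale c (f i))"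
  by (induction S rule: infinite_finite_induct) (simp_all add: pscale_add)

lemma pscale_single: "pscale c (Poly_Mapping.single i d) = Poly_Mapping.single i (c * d)"
  by (rule poly_mapping_eqI) (simp add: lookup_single when_def)

lemma keys_pscale: "Poly_Mapping.keys (pscale c p) \<subseteq> Poly_Mapping.keys p"
  by (auto simp: in_keys_iff)

lemma lookup_lincomb:
  "Poly_Mapping.lookup (lincomb c x) i =
    (\<Sum>q\<in>Poly_Mapping.keys c. Poly_Mapping.lookup c q * Poly_Mapping.lookup (x q) i)"
  by (simp add: lincomb_def lookup_sum)

lemma lincomb_superset:
  assumes "finite S" "Poly_Mapping.keys c \<subseteq> S"
  shows "lincomb c x = (\<Sum>q\<in>S. pscale (Poly_Mapping.lookup c q) (x q))"
  unfolding lincomb_def using assms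
  by (intro sum.mono_neutral_left) (auto simp: in_keys_iff)

lemma lincomb_cong:
  "(\<And>q. q \<in> Poly_Mapping.keys c \<Longrightarrow> x q = y q) \<Longrightarrow> lincomb c x = lincomb c y"
  by (simp add: lincomb_def)

lemma lincomb_0 [simp]: "lincomb 0 x = 0" "lincomb c (\<lambda>_. 0) = 0"
  by (simp_all add: lincomb_def)

lemma lincomb_single [simp]: "lincomb (Poly_Mapping.single q a) x = pscale a (x q)"
  by (subst lincomb_superset[of "{q}"]) auto

lemma lincomb_add: "lincomb (c + d) x = lincomb c x + lincomb d x"
  using keys_add[of c d]
  by (subst (1 2 3) lincomb_superset[of "Poly_Mapping.keys c \<union> Poly_Mapping.keys d"])
     (auto simp: lookup_add pscale_add_left sum.distrib)

lemma lincomb_pscale: "lincomb (pscale a c) x = pscale a (lincomb c x)"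
  using keys_pscale[of a c]
  by (subst (1 2) lincomb_superset[of "Poly_Mapping.keys c"]) (auto simp: pscale_sum)

lemma lincomb_sum: "lincomb (\<Sum>i\<in>S. c i) x = (\<Sum>i\<in>S. lincomb (c i) x)"
  by (induction S rule: infinite_finite_induct) (simp_all add: lincomb_add)

lemma lincomb_minus: "lincomb (c - d) x = lincomb c x - lincomb d x"
proof -
  have "lincomb (c - d) x + lincomb d x = lincomb c x"
    by (simp flip: lincomb_add)
  then show ?thesis by (simp add: algebra_simps)
qed

lemma lincomb_add_right: "lincomb c (\<lambda>q. x q + y q) = lincomb c x + lincomb c y"
  by (simp add: lincomb_def pscale_add sum.distrib)

lemma lincomb_pscale_right: "lincomb c (\<lambda>q. pscale a (x q)) = pscale a (lincomb c x)"
  by (simp add: lincomb_def pscale_sum mult.commute)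

text \<open>Both associativity of composition and naturality of coordinates are instances of this law.\<close>

lemma lincomb_assoc: "lincomb (lincomb c x) y = lincomb c (\<lambda>q. lincomb (x q) y)"
proof -
  have "lincomb (lincomb c x) y =
      (\<Sum>q\<in>Poly_Mapping.keys c. lincomb (pscale (Poly_Mapping.lookup c q) (x q)) y)"
    by (subst lincomb_def) (simp add: lincomb_sum)
  then show ?thesis by (simp add: lincomb_pscale lincomb_def[of c])
qed

lemma lincomb_swap:
  "lincomb a (\<lambda>i. lincomb b (f i)) = lincomb b (\<lambda>j. lincomb a (\<lambda>i. f i j))"
  unfolding lincomb_def pscale_sum pscale_pscale
  by (subst sum.swap) (simp add: mult.commute)

text \<open>The rows of \<open>pid I\<close> at indices in \<open>I\<close> are unit vectors; this is why it is an identity.\<close>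

lemma lincomb_unit: "lincomb c (\<lambda>q. Poly_Mapping.single q 1) = c"
proof (rule poly_mapping_eqI)
  fix i
  have "Poly_Mapping.lookup (lincomb c (\<lambda>q. Poly_Mapping.single q 1)) i =
      (\<Sum>q\<in>Poly_Mapping.keys c. if q = i then Poly_Mapping.lookup c i else 0)"
    unfolding lookup_lincomb by (rule sum.cong) (auto simp: lookup_single when_def)
  then show "Poly_Mapping.lookup (lincomb c (\<lambda>q. Poly_Mapping.single q 1)) i =
      Poly_Mapping.lookup c i"
    by (simp add: in_keys_iff)
qed

lemma keys_lincomb: "Poly_Mapping.keys (lincomb c x) \<subseteq> (\<Union>q\<in>Poly_Mapping.keys c. Poly_Mapping.keys (x q))"
proof
  fix i assume "i \<in> Poly_Mapping.keys (lincomb c x)"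
  then have "(\<Sum>q\<in>Poly_Mapping.keys c. Poly_Mapping.lookup c q * Poly_Mapping.lookup (x q) i) \<noteq> 0"
    by (simp add: in_keys_iff lookup_lincomb)
  then obtain q where "q \<in> Poly_Mapping.keys c" "Poly_Mapping.lookup (x q) i \<noteq> 0"
    by (metis (mono_tags, lifting) mult_zero_right sum.neutral)
  then show "i \<in> (\<Union>q\<in>Poly_Mapping.keys c. Poly_Mapping.keys (x q))"
    by (auto simp: in_keys_iff)
qed


section \<open>Morphisms of profinite vector spaces\<close>

lemma pcomp_eq: "pcomp g f = (\<lambda>l. lincomb (g l) f)"
  by (simp add: pcomp_def lincomb_def)

lemma ptens_eq:
  "ptens f g (j, j2) =
    lincomb (f j) (\<lambda>i. lincomb (g j2) (\<lambda>i2. Poly_Mapping.single (i, i2) 1))"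
  by (simp add: ptens_def lincomb_def pscale_single pscale_sum)

lemma pcomp_assoc: "pcomp h (pcomp g f) = pcomp (pcomp h g) f"
  by (rule ext) (simp add: pcomp_eq lincomb_assoc)

lemma pcomp_pid:
  "f \<in> phom I J \<Longrightarrow> pcomp (pid J) f = f"
  "f \<in> phom I J \<Longrightarrow> pcomp f (pid I) = f"
proof -
  assume f: "f \<in> phom I J"
  show "pcomp (pid J) f = f"
    using f by (intro ext) (auto simp: pcomp_eq pid_def phom_def)
  show "pcomp f (pid I) = f"
  proof
    fix j
    have "lincomb (f j) (pid I) = lincomb (f j) (\<lambda>q. Poly_Mapping.single q 1)"
      using f by (intro lincomb_cong) (cases "j \<in> J"; auto simp: pid_def phom_def)
    then show "pcomp f (pid I) j = f j" by (simp add: pcomp_eq lincomb_unit)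
  qed
qed

lemma pcomp_add_left: "pcomp (\<lambda>j. f j + g j) h = (\<lambda>j. pcomp f h j + pcomp g h j)"
  by (rule ext) (simp add: pcomp_eq lincomb_add)

lemma pcomp_add_right: "pcomp h (\<lambda>j. f j + g j) = (\<lambda>j. pcomp h f j + pcomp h g j)"
  by (rule ext) (simp add: pcomp_eq lincomb_add_right)

lemma pcomp_pscale_left: "pcomp (\<lambda>j. pscale c (f j)) h = (\<lambda>j. pscale c (pcomp f h j))"
  by (rule ext) (simp add: pcomp_eq lincomb_pscale)

lemma pcomp_pscale_right: "pcomp h (\<lambda>j. pscale c (f j)) = (\<lambda>j. pscale c (pcomp h f j))"
  by (rule ext) (simp add: pcomp_eq lincomb_pscale_right)

lemma pcomp_zero [simp]: "pcomp (\<lambda>_. 0) f = (\<lambda>_. 0)" "pcomp f (\<lambda>_. 0) = (\<lambda>_. 0)"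
  by (rule ext, simp add: pcomp_eq)+

lemma pid_in_phom: "I \<subseteq> J \<Longrightarrow> pid I \<in> phom I J"
  by (auto simp: phom_def pid_def)

lemma pcomp_in_phom: "g \<in> phom J L \<Longrightarrow> f \<in> phom I J \<Longrightarrow> pcomp g f \<in> phom I L"
  by (auto simp: phom_def pcomp_eq intro!: order.trans[OF keys_lincomb] UN_least)

lemma ptens_in_phom:
  assumes "f \<in> phom I J" "g \<in> phom I' J'"
  shows "ptens f g \<in> phom (I \<times> I') (J \<times> J')"
  unfolding phom_def
proof (intro CollectI conjI ballI allI impI)
  fix jj assume "jj \<in> J \<times> J'"
  then obtain j j' where j: "jj = (j, j')" "j \<in> J" "j' \<in> J'" by auto
  have "Poly_Mapping.keys (f j) \<subseteq> I" "Poly_Mapping.keys (g j') \<subseteq> I'"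
    using assms j by (auto simp: phom_def)
  then show "Poly_Mapping.keys (ptens f g jj) \<subseteq> I \<times> I'"
    unfolding j(1) ptens_eq
    by (intro order.trans[OF keys_lincomb] UN_least) auto
next
  fix jj assume "jj \<notin> J \<times> J'"
  then have "f (fst jj) = 0 \<or> g (snd jj) = 0" using assms by (cases jj) (auto simp: phom_def)
  then show "ptens f g jj = 0" by (cases jj) (auto simp: ptens_eq)
qed

lemma phom_add: "f \<in> phom I J \<Longrightarrow> g \<in> phom I J \<Longrightarrow> (\<lambda>j. f j + g j) \<in> phom I J"
  by (auto simp: phom_def intro!: order.trans[OF keys_add])

lemma phom_pscale: "f \<in> phom I J \<Longrightarrow> (\<lambda>j. pscale c (f j)) \<in> phom I J"
  by (auto simp: phom_def intro!: order.trans[OF keys_pscale])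

lemma phom_zero [simp]: "(\<lambda>_. 0) \<in> phom I J"
  by (simp add: phom_def)

lemma ptens_pcomp: "ptens (pcomp f f') (pcomp g g') = pcomp (ptens f g) (ptens f' g')"
proof
  fix jj
  show "ptens (pcomp f f') (pcomp g g') jj = pcomp (ptens f g) (ptens f' g') jj"
  proof (cases jj)
    case (Pair j j')
    have "lincomb (f j) (\<lambda>i. lincomb (f' i) (\<lambda>a. lincomb (g j') (\<lambda>i'. lincomb (g' i')
          (\<lambda>b. Poly_Mapping.single (a, b) 1)))) =
        lincomb (f j) (\<lambda>i. lincomb (g j') (\<lambda>i'. lincomb (f' i) (\<lambda>a. lincomb (g' i')
          (\<lambda>b. Poly_Mapping.single (a, b) 1))))"
      by (intro lincomb_cong lincomb_swap)
    then show ?thesis by (simp add: Pair pcomp_eq ptens_eq lincomb_assoc)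
  qed
qed

text \<open>The isomorphism \<open>\<Prod>\<^sub>L k \<rightarrow> \<Prod>\<^sub>J k\<close> that renames the coordinates along a bijection \<open>b : L \<rightarrow> J\<close>,
  and its inverse.\<close>

definition reindex :: "('l \<Rightarrow> 'j) \<Rightarrow> 'l set \<Rightarrow> 'j set \<Rightarrow> ('l, 'j, 'k::field) pmap"
  where "reindex b L J = (\<lambda>j. if j \<in> J then Poly_Mapping.single (inv_into L b j) 1 else 0)"

definition reindex_inv :: "('l \<Rightarrow> 'j) \<Rightarrow> 'l set \<Rightarrow> ('j, 'l, 'k::field) pmap"
  where "reindex_inv b L = (\<lambda>l. if l \<in> L then Poly_Mapping.single (b l) 1 else 0)"

lemma reindex_in_phom: "bij_betw b L J \<Longrightarrow> reindex b L J \<in> phom L J"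
  by (auto simp: phom_def reindex_def inv_into_into bij_betw_def)

lemma reindex_inv_in_phom: "bij_betw b L J \<Longrightarrow> reindex_inv b L \<in> phom J L"
  by (auto simp: phom_def reindex_inv_def bij_betw_def)

lemma reindex_reindex_inv: "bij_betw b L J \<Longrightarrow> pcomp (reindex b L J) (reindex_inv b L) = pid J"
  by (auto simp: fun_eq_iff pcomp_eq reindex_def reindex_inv_def pid_def bij_betw_def
      inv_into_into f_inv_into_f)


section \<open>Small index sets\<close>

lemma small_subset: "I \<subseteq> J \<Longrightarrow> small J \<Longrightarrow> small I"
  unfolding small_def using card_of_mono1 ordLeq_ordLess_trans by blast

lemma finite_ordLess_UNIV:
  assumes "infinite (UNIV :: 'u set)" "finite I"
  shows "|I| <o |UNIV :: 'u set|"
  using assms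
  by (intro finite_ordLess_infinite[OF card_of_Well_order card_of_Well_order])
     (simp_all add: Field_card_of)

lemma small_finite: "infinite (UNIV :: 'u set) \<Longrightarrow> finite (I :: 'u set) \<Longrightarrow> small I"
  unfolding small_def by (rule finite_ordLess_UNIV)

text \<open>
  Tensor products live on index sets \<open>I \<times> J\<close> of pairs, whereas sections are evaluated only at
  subsets of \<open>'u\<close>; this provides the copies of \<open>I \<times> J\<close> that turn a generic tensor into a section.
  If \<open>I\<close> or \<open>J\<close> is infinite and neither is empty, the product has the larger of the two cardinalities.
\<close>

lemma small_product:
  assumes inf: "infinite (UNIV :: 'u set)" and I: "small (I :: 'u set)" and J: "small (J :: 'u set)"
  obtains L :: "'u set" and b where "small L" "bij_betw b L (I \<times> J)"
proof -
  have lt: "|I \<times> J| <o |UNIV :: 'u set|"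
  proof (cases "finite I \<and> finite J \<or> I = {} \<or> J = {}")
    case True
    then have "finite (I \<times> J)" by auto
    then show ?thesis using inf by (rule finite_ordLess_UNIV[rotated])
  next
    case False
    have "|I| \<le>o |J| \<or> |J| \<le>o |I|" by (rule ordLeq_total[OF card_of_Well_order card_of_Well_order])
    then show ?thesis
    proof
      assume le: "|I| \<le>o |J|"
      then have "infinite J" using False card_of_ordLeq_infinite by blast
      then have "|I \<times> J| =o |J|" using card_of_Times_infinite[of J I] le False by blast
      then show ?thesis using J unfolding small_def by (rule ordIso_ordLess_trans)
    next
      assume le: "|J| \<le>o |I|"
      then have "infinite I" using False card_of_ordLeq_infinite by blast
      then have "|I \<times> J| =o |I|" using card_of_Times_infinite[of I J] le False by blast
      then show ?thesis using I unfolding small_def by (rule ordIso_ordLess_trans)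
    qed
  qed
  then obtain f :: "'u \<times> 'u \<Rightarrow> 'u" where f: "inj_on f (I \<times> J)"
    using card_of_ordLeq ordLess_imp_ordLeq by (metis card_of_ordLeq)
  then have bf: "bij_betw f (I \<times> J) (f ` (I \<times> J))" by (simp add: inj_on_imp_bij_betw)
  have "|f ` (I \<times> J)| <o |UNIV :: 'u set|"
    using lt card_of_image ordLeq_ordLess_trans by blast
  then show thesis
    using that[of "f ` (I \<times> J)" "inv_into (I \<times> J) f"] bij_betw_inv_into[OF bf]
    by (simp add: small_def)
qed


section \<open>Classes of formal sums in the tensor product\<close>

text \<open>An element of \<open>F \<otimes> G\<close> is handled through a formal sum representing it; the operations of the
  tensor product become the evident ones on representatives.\<close>

abbreviation trel_span ::
  "('k::field, 'u, 'a, 'y) presheaf_scheme \<Rightarrow> ('k, 'u, 'b, 'z) presheaf_scheme \<Rightarrow> 'u set \<Rightarrow>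
   (('k, 'u, 'a, 'b) tgen \<Rightarrow>\<^sub>0 'k) set"
  where "trel_span F G K \<equiv> lspan (tfree F G) K (trels F G K)"

abbreviation tclass ::
  "('k::field, 'u, 'a, 'y) presheaf_scheme \<Rightarrow> ('k, 'u, 'b, 'z) presheaf_scheme \<Rightarrow> 'u set \<Rightarrow>
   (('k, 'u, 'a, 'b) tgen \<Rightarrow>\<^sub>0 'k) \<Rightarrow> ('k, 'u, 'a, 'b) tensor"
  where "tclass F G K p \<equiv> coset (tfree F G) (\<lambda>K. trel_span F G K) K p"

lemma tfree_simps [simp]:
  "sec (tfree F G) K = {p. Poly_Mapping.keys p \<subseteq> tgens F G K}"
  "vzero (tfree F G) K = 0"
  "vadd (tfree F G) K p q = p + q"
  "vscale (tfree F G) K c p = pscale c p"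
  by (simp_all add: tfree_def)

lemma pull_tfree:
  "pull (tfree F G) K L f p = lincomb p (\<lambda>(I, J, \<phi>, x, y). gen (I, J, pcomp \<phi> f, x, y))"
  by (auto simp: tfree_def lincomb_def pscale_single intro!: sum.cong)

lemma trel_span_zero: "0 \<in> trel_span F G K"
  using lspan.zero[of "tfree F G" K] by simp

lemma trel_span_add: "p \<in> trel_span F G K \<Longrightarrow> q \<in> trel_span F G K \<Longrightarrow> p + q \<in> trel_span F G K"
  using lspan.add[of p "tfree F G" K _ q] by simp

lemma trel_span_pscale: "p \<in> trel_span F G K \<Longrightarrow> pscale c p \<in> trel_span F G K"
  using lspan.scale[of p "tfree F G" K _ c] by simp

lemma trel_span_uminus: "p \<in> trel_span F G K \<Longrightarrow> - p \<in> trel_span F G K"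
  using trel_span_pscale[of p F G K "-1"] by (simp add: pscale_minus_one)

lemma trel_span_diff: "p \<in> trel_span F G K \<Longrightarrow> q \<in> trel_span F G K \<Longrightarrow> p - q \<in> trel_span F G K"
  using trel_span_add[OF _ trel_span_uminus, of p F G K q] by simp

lemma mem_tclass: "q \<in> tclass F G K p \<longleftrightarrow> q - p \<in> trel_span F G K"
proof
  assume "q - p \<in> trel_span F G K"
  then show "q \<in> tclass F G K p" by (auto simp: coset_def intro!: exI[of _ "q - p"])
qed (auto simp: coset_def)

lemma tclass_self: "p \<in> tclass F G K p"
  by (simp add: mem_tclass trel_span_zero)

lemma tclass_nonempty [simp]: "tclass F G K p \<noteq> {}"
  using tclass_self by blast

lemma tclass_eq: "q - p \<in> trel_span F G K \<Longrightarrow> tclass F G K q = tclass F G K p"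
proof -
  assume a: "q - p \<in> trel_span F G K"
  have "r - q \<in> trel_span F G K \<longleftrightarrow> r - p \<in> trel_span F G K" for r
    using trel_span_add[OF _ a, of "r - q"] trel_span_diff[OF _ a, of "r - p"] by auto
  then show ?thesis by (auto simp: mem_tclass)
qed

text \<open>The operations on a quotient are unions over representatives; such a union collapses to one class
  when all the classes involved agree.\<close>

lemma Union_tclass_eqI:
  "X \<noteq> {} \<Longrightarrow> (\<And>p. p \<in> X \<Longrightarrow> f p - q \<in> trel_span F G K) \<Longrightarrow>
    (\<Union>p\<in>X. tclass F G K (f p)) = tclass F G K q"
  by (rule SUP_eq_const) (simp_all add: tclass_eq)

lemma sec_tensor: "sec (tensor F G) K = tclass F G K ` {p. Poly_Mapping.keys p \<subseteq> tgens F G K}"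
  by (simp add: tensor_def quot_def)

lemma vzero_tensor: "vzero (tensor F G) K = tclass F G K 0"
  by (simp add: tensor_def quot_def)

lemma vadd_tensor: "vadd (tensor F G) K (tclass F G K p) (tclass F G K q) = tclass F G K (p + q)"
proof -
  have "vadd (tensor F G) K (tclass F G K p) (tclass F G K q) =
      (\<Union>x\<in>tclass F G K p. \<Union>y\<in>tclass F G K q. tclass F G K (x + y))"
    by (simp add: tensor_def quot_def)
  also have "\<dots> = (\<Union>x\<in>tclass F G K p. tclass F G K (x + q))"
    by (intro SUP_cong refl Union_tclass_eqI) (simp_all add: mem_tclass)
  also have "\<dots> = tclass F G K (p + q)"
    by (intro Union_tclass_eqI) (simp_all add: mem_tclass)
  finally show ?thesis .
qed

lemma vscale_tensor: "vscale (tensor F G) K c (tclass F G K p) = tclass F G K (pscale c p)"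
proof -
  have "pscale c x - pscale c p = pscale c (x - p)" for x
    by (rule poly_mapping_eqI) (simp add: lookup_minus right_diff_distrib)
  then show ?thesis
    unfolding tensor_def quot_def
    by (simp, intro Union_tclass_eqI) (simp_all add: mem_tclass trel_span_pscale)
qed

lemma tgens_pcomp:
  "f \<in> phom K L \<Longrightarrow> (I, J, \<phi>, x, y) \<in> tgens F G L \<Longrightarrow> (I, J, pcomp \<phi> f, x, y) \<in> tgens F G K"
  using pcomp_in_phom by (auto simp: tgens_def)

text \<open>Precomposition with \<open>f\<close> changes only the entry \<open>\<phi>\<close>, is linear in it and commutes with
  postcomposition, so it takes each relation to a relation of the same kind.\<close>

lemma pull_trel_span:
  assumes f: "f \<in> phom K L" and p: "p \<in> trel_span F G L"
  shows "pull (tfree F G) K L f p \<in> trel_span F G K"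
  using p
proof induction
  case (base p)
  note g = tgens_pcomp[OF f]
  have "pull (tfree F G) K L f p \<in> trels F G K"
    using base
  proof cases
    case (add_hom I J \<phi> x y \<psi>)
    then show ?thesis
      using trels.add_hom[OF g g] by (simp add: pull_tfree lincomb_minus pcomp_add_left)
  next
    case (scale_hom I J \<phi> x y c)
    then show ?thesis
      using trels.scale_hom[OF g]
      by (simp add: pull_tfree lincomb_minus lincomb_pscale pcomp_pscale_left)
  next
    case (add_left I J \<phi> x y x')
    then show ?thesis
      using trels.add_left[OF g g] by (simp add: pull_tfree lincomb_minus)
  next
    case (scale_left I J \<phi> x y c)
    then show ?thesis
      using trels.scale_left[OF g] by (simp add: pull_tfree lincomb_minus lincomb_pscale)
  next
    case (add_right I J \<phi> x y y')
    then show ?thesis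
      using trels.add_right[OF g g] by (simp add: pull_tfree lincomb_minus)
  next
    case (scale_right I J \<phi> x y c)
    then show ?thesis
      using trels.scale_right[OF g] by (simp add: pull_tfree lincomb_minus lincomb_pscale)
  next
    case (dinatural I J I' J' \<phi> h h' x y)
    then show ?thesis
      using trels.dinatural[OF dinatural(2-5) pcomp_in_phom[OF dinatural(6) f] dinatural(7-10)]
      by (simp add: pull_tfree lincomb_minus pcomp_assoc)
  qed
  then show ?case by (rule lspan.base)
next
  case (add p q)
  then show ?case using trel_span_add by (simp add: pull_tfree lincomb_add)
next
  case (scale p c)
  then show ?case using trel_span_pscale by (simp add: pull_tfree lincomb_pscale)
qed (simp add: pull_tfree trel_span_zero)

lemma pull_tensor:
  assumes f: "f \<in> phom K L"
  shows "pull (tensor F G) K L f (tclass F G L p) = tclass F G K (pull (tfree F G) K L f p)"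
proof -
  have "pull (tfree F G) K L f q - pull (tfree F G) K L f p = pull (tfree F G) K L f (q - p)" for q
    by (simp add: pull_tfree lincomb_minus)
  then show ?thesis
    unfolding tensor_def quot_def
    by (simp, intro Union_tclass_eqI) (simp_all add: mem_tclass pull_trel_span[OF f])
qed

text \<open>The inclusion in the form in which it compares the generators and relations of tensor products.
  It concerns small index sets, since the powers of an ideal are known to consist of sections of
  \<open>A\<close> only there.\<close>

definition subpresheaf ::
  "('k::field, 'u, 'a, 'y) presheaf_scheme \<Rightarrow> ('k, 'u, 'a, 'z) presheaf_scheme \<Rightarrow> bool"
  where "subpresheaf F F' \<longleftrightarrow> (\<forall>I. small I \<longrightarrow> sec F I \<subseteq> sec F' I) \<and> pull F = pull F' \<and>
    vadd F = vadd F' \<and> vscale F = vscale F'"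

lemma subpresheaf_refl [simp]: "subpresheaf F F"
  by (simp add: subpresheaf_def)

lemma tgens_mono:
  "subpresheaf F F' \<Longrightarrow> subpresheaf G G' \<Longrightarrow> tgens F G K \<subseteq> tgens F' G' K"
  by (auto simp: tgens_def subpresheaf_def)

lemma trels_mono:
  assumes F: "subpresheaf F F'" and G: "subpresheaf G G'"
  shows "trels F G K \<subseteq> trels F' G' K"
proof
  have tg: "g \<in> tgens F' G' K" if "g \<in> tgens F G K" for g
    using tgens_mono[OF F G] that by blast
  have [simp]: "vadd F = vadd F'" "vscale F = vscale F'" "pull F = pull F'"
    "vadd G = vadd G'" "vscale G = vscale G'" "pull G = pull G'"
    using F G by (simp_all add: subpresheaf_def)
  fix p assume "p \<in> trels F G K"
  then show "p \<in> trels F' G' K"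
  proof cases
    case (add_hom I J \<phi> x y \<psi>)
    then show ?thesis using trels.add_hom[OF tg tg] by simp
  next
    case (scale_hom I J \<phi> x y c)
    then show ?thesis using trels.scale_hom[OF tg] by simp
  next
    case (add_left I J \<phi> x y x')
    then show ?thesis using trels.add_left[OF tg tg] by simp
  next
    case (scale_left I J \<phi> x y c)
    then show ?thesis using trels.scale_left[OF tg] by simp
  next
    case (add_right I J \<phi> x y y')
    then show ?thesis using trels.add_right[OF tg tg] by simp
  next
    case (scale_right I J \<phi> x y c)
    then show ?thesis using trels.scale_right[OF tg] by simp
  next
    case (dinatural I J I' J' \<phi> h h' x y)
    moreover have "x \<in> sec F' I'" "y \<in> sec G' J'" using F G dinatural by (auto simp: subpresheaf_def)
    ultimately show ?thesis
      using trels.dinatural[OF dinatural(2-8), of x F' y G'] by simp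
  qed
qed

lemma trel_span_mono:
  assumes "subpresheaf F F'" and "subpresheaf G G'"
  shows "trel_span F G K \<subseteq> trel_span F' G' K"
proof
  fix p assume "p \<in> trel_span F G K"
  then show "p \<in> trel_span F' G' K"
  proof induction
    case (base p)
    then show ?case using trels_mono[OF assms] by (blast intro: lspan.base)
  next
    case (add p q)
    then show ?case using trel_span_add by simp
  next
    case (scale p c)
    then show ?case using trel_span_pscale by simp
  qed (simp add: trel_span_zero)
qed

text \<open>The relations of the smaller presheaves are relations of the larger ones, so the map induced by the
  inclusions keeps representatives.\<close>

lemma tensor_incl_tclass:
  assumes "subpresheaf F F'" and "subpresheaf G G'"
  shows "tensor_incl F' G' K (tclass F G K p) = tclass F' G' K p"
  unfolding tensor_incl_def
  using trel_span_mono[OF assms, of K]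
  by (intro Union_tclass_eqI) (auto simp: mem_tclass)


section \<open>Coordinates on profinite modules\<close>

text \<open>
  The isomorphism \<open>h\<close> identifies sections over \<open>I\<close> with morphisms \<open>\<Prod>\<^sub>I k \<rightarrow> \<Prod>\<^sub>Q k\<close>.  The section \<open>univ\<close>
  is the one given by the identity, and a section is the pullback of \<open>univ\<close> along its coordinates.
\<close>

locale profinite_coords =
  fixes F :: "('k::field, 'u, 'a, 'z) presheaf_scheme"
    and Q :: "'u set"
    and h :: "'u set \<Rightarrow> ('u, 'u, 'k) pmap \<Rightarrow> 'a"
  assumes ultrasolid: "ultrasolid F"
    and small_Q: "small Q"
    and iso: "isomorphism (yoneda Q) F h"
begin

definition coord :: "'u set \<Rightarrow> 'a \<Rightarrow> ('u, 'u, 'k) pmap"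
  where "coord I x = inv_into (phom I Q) (h I) x"

definition univ :: 'a
  where "univ = h Q (pid Q)"

lemma bij_h: "small I \<Longrightarrow> bij_betw (h I) (phom I Q) (sec F I)"
  using iso by (simp add: isomorphism_def yoneda_def)

lemma h_in_sec: "small I \<Longrightarrow> f \<in> phom I Q \<Longrightarrow> h I f \<in> sec F I"
  using bij_h bij_betwE by blast

lemma h_inject: "small I \<Longrightarrow> f \<in> phom I Q \<Longrightarrow> g \<in> phom I Q \<Longrightarrow> h I f = h I g \<Longrightarrow> f = g"
  using bij_h by (meson bij_betw_def inj_onD)

lemma coord_in_phom: "small I \<Longrightarrow> x \<in> sec F I \<Longrightarrow> coord I x \<in> phom I Q"
  using bij_h[of I] by (auto simp: coord_def bij_betw_def inv_into_into)

lemma h_coord: "small I \<Longrightarrow> x \<in> sec F I \<Longrightarrow> h I (coord I x) = x"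
  using bij_h[of I] by (auto simp: coord_def bij_betw_def f_inv_into_f)

lemma coord_h: "small I \<Longrightarrow> f \<in> phom I Q \<Longrightarrow> coord I (h I f) = f"
  using bij_h[of I] by (auto simp: coord_def bij_betw_def)

lemma pull_h:
  "small I \<Longrightarrow> small J \<Longrightarrow> f \<in> phom I J \<Longrightarrow> x \<in> phom J Q \<Longrightarrow>
    pull F I J f (h J x) = h I (pcomp x f)"
  using iso by (simp add: isomorphism_def morphism_def yoneda_def)

lemma pull_in_sec:
  "small I \<Longrightarrow> small J \<Longrightarrow> f \<in> phom I J \<Longrightarrow> x \<in> sec F J \<Longrightarrow> pull F I J f x \<in> sec F I"
  using ultrasolid by (simp add: ultrasolid_def)

lemma univ_in_sec: "univ \<in> sec F Q"
  unfolding univ_def by (intro h_in_sec small_Q pid_in_phom) simp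

lemma coord_univ: "coord Q univ = pid Q"
  unfolding univ_def by (intro coord_h small_Q pid_in_phom) simp

lemma pull_univ: "small I \<Longrightarrow> f \<in> phom I Q \<Longrightarrow> pull F I Q f univ = h I f"
  using pull_h[OF _ small_Q, of I f "pid Q"] by (simp add: univ_def pid_in_phom pcomp_pid)

lemma pull_coord_univ: "small I \<Longrightarrow> x \<in> sec F I \<Longrightarrow> pull F I Q (coord I x) univ = x"
  by (simp add: pull_univ coord_in_phom h_coord)

text \<open>An isomorphism is only required to commute with pullbacks.  It is additive because the addition of
  sections that are pulled back from a common section is the addition of morphisms.\<close>

lemma vadd_h:
  assumes "small I" "f \<in> phom I Q" "g \<in> phom I Q"
  shows "vadd F I (h I f) (h I g) = h I (\<lambda>q. f q + g q)"
proof -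
  have "pull F I Q (\<lambda>q. f q + g q) univ = vadd F I (pull F I Q f univ) (pull F I Q g univ)"
    using ultrasolid assms small_Q univ_in_sec by (simp add: ultrasolid_def)
  then show ?thesis using assms by (simp add: pull_univ phom_add)
qed

lemma vzero_h:
  assumes "small I"
  shows "vzero F I = h I (\<lambda>_. 0)"
proof -
  have "pull F I Q (\<lambda>_. 0) univ = vzero F I"
    using ultrasolid assms small_Q univ_in_sec by (simp add: ultrasolid_def)
  then show ?thesis using assms by (simp add: pull_univ)
qed

end


section \<open>Pairings of profinite modules\<close>

text \<open>
  The action \<open>A \<otimes> M \<rightarrow> M\<close> and the multiplication \<open>A \<otimes> A \<rightarrow> A\<close> are treated alike.
\<close>

locale profinite_pairing =
  A: profinite_coords A Q hA + M: profinite_coords M P hM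
  for A :: "('k::field, 'u, 'a, 'y) presheaf_scheme" and Q hA
    and M :: "('k, 'u, 'm, 'z) presheaf_scheme" and P hM +
  fixes \<alpha> :: "'u set \<Rightarrow> ('k, 'u, 'a, 'm) tensor \<Rightarrow> 'm"
  assumes infinite_UNIV: "infinite (UNIV :: 'u set)"
    and morphism: "morphism (tensor A M) M \<alpha>"
begin

text \<open>
  The image of a formal sum under \<open>A \<otimes> M = \<Prod>\<^sub>Q k \<otimes> \<Prod>\<^sub>P k = \<Prod>\<^bsub>Q\<times>P\<^esub> k\<close>.
\<close>

definition tcoord :: "(('k, 'u, 'a, 'm) tgen \<Rightarrow>\<^sub>0 'k) \<Rightarrow> ('u, 'u \<times> 'u, 'k) pmap"
  where "tcoord p =
    (\<lambda>j. lincomb p (\<lambda>(I, J, \<phi>, x, y). pcomp (ptens (A.coord I x) (M.coord J y)) \<phi> j))"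

lemma tcoord_gen [simp]:
  "tcoord (gen (I, J, \<phi>, x, y)) = pcomp (ptens (A.coord I x) (M.coord J y)) \<phi>"
  by (simp add: tcoord_def)

lemma tcoord_linear:
  "tcoord (p + q) = (\<lambda>j. tcoord p j + tcoord q j)"
  "tcoord (p - q) = (\<lambda>j. tcoord p j - tcoord q j)"
  "tcoord (pscale c p) = (\<lambda>j. pscale c (tcoord p j))"
  by (simp_all add: tcoord_def lincomb_add lincomb_minus lincomb_pscale)

abbreviation uten :: "'u set \<Rightarrow> ('u, 'u \<times> 'u, 'k) pmap \<Rightarrow> ('k, 'u, 'a, 'm) tensor"
  where "uten K \<phi> \<equiv> ten A M K Q P \<phi> A.univ M.univ"

lemma uten_gen: "\<phi> \<in> phom K (Q \<times> P) \<Longrightarrow> (Q, P, \<phi>, A.univ, M.univ) \<in> tgens A M K"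
  by (simp add: tgens_def A.small_Q M.small_Q A.univ_in_sec M.univ_in_sec)

lemma tcoord_summand_in_phom:
  "(I, J, \<phi>, x, y) \<in> tgens A M K \<Longrightarrow> pcomp (ptens (A.coord I x) (M.coord J y)) \<phi> \<in> phom K (Q \<times> P)"
  by (auto simp: tgens_def intro!: pcomp_in_phom ptens_in_phom A.coord_in_phom M.coord_in_phom)

text \<open>Every tensor is a pure tensor of the two universal sections: each generator becomes one by
  dinaturality, and such generators can be added in their middle component.\<close>

lemma tclass_eq_uten:
  assumes p: "Poly_Mapping.keys p \<subseteq> tgens A M K"
  shows "tcoord p \<in> phom K (Q \<times> P)" and "tclass A M K p = uten K (tcoord p)"
proof -
  define G where "G = (\<lambda>\<phi>. gen (Q, P, \<phi>, A.univ, M.univ) :: ('k, 'u, 'a, 'm) tgen \<Rightarrow>\<^sub>0 'k)"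
  define s where "s = (\<lambda>S. \<Sum>g\<in>S. pscale (Poly_Mapping.lookup p g) (gen g))"
  have "tcoord (s S) \<in> phom K (Q \<times> P) \<and> s S - G (tcoord (s S)) \<in> trel_span A M K"
    if "finite S" "S \<subseteq> tgens A M K" for S
    using that
  proof (induction S rule: finite_induct)
    case empty
    \<comment> \<open>Scaling by zero makes the generator with middle component zero a relation.\<close>
    have "gen (Q, P, (\<lambda>j. pscale 0 0), A.univ, M.univ) - pscale 0 (G (\<lambda>_. 0)) \<in> trels A M K"
      unfolding G_def by (intro trels.scale_hom uten_gen) simp
    then have "G (\<lambda>_. 0) \<in> trel_span A M K"
      unfolding G_def by (intro lspan.base) simp
    then show ?case using trel_span_uminus by (fastforce simp: s_def tcoord_def)
  next
    case (insert g S)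
    obtain I J \<phi> x y where g: "g = (I, J, \<phi>, x, y)" by (cases g)
    define c where "c = Poly_Mapping.lookup p g"
    define \<psi> where "\<psi> = pcomp (ptens (A.coord I x) (M.coord J y)) \<phi>"
    define \<psi>' where "\<psi>' = (\<lambda>j. pscale c (\<psi> j))"
    define \<chi> where "\<chi> = tcoord (s S)"
    have \<chi>: "\<chi> \<in> phom K (Q \<times> P)" and IH: "s S - G \<chi> \<in> trel_span A M K"
      using insert by (auto simp: \<chi>_def)
    have gK: "(I, J, \<phi>, x, y) \<in> tgens A M K" using insert g by simp
    have \<psi>: "\<psi> \<in> phom K (Q \<times> P)"
      unfolding \<psi>_def by (rule tcoord_summand_in_phom[OF gK])
    then have \<psi>': "\<psi>' \<in> phom K (Q \<times> P)" unfolding \<psi>'_def by (rule phom_pscale)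
    have s: "s (insert g S) = pscale c (gen g) + s S"
      using insert by (simp add: s_def c_def)
    have tcoord_g: "tcoord (gen g) = \<psi>"
      unfolding g \<psi>_def by (rule tcoord_gen)
    have tc: "tcoord (s (insert g S)) = (\<lambda>j. \<psi>' j + \<chi> j)"
      by (simp add: s tcoord_linear tcoord_g \<psi>'_def \<chi>_def)
    have sec: "small I" "small J" "\<phi> \<in> phom K (I \<times> J)" "x \<in> sec A I" "y \<in> sec M J"
      using gK by (auto simp: tgens_def)
    \<comment> \<open>Both arguments of the new generator are pullbacks of universal sections.\<close>
    have "gen (I, J, \<phi>, pull A I Q (A.coord I x) A.univ, pull M J P (M.coord J y) M.univ) - G \<psi>
        \<in> trels A M K"
      unfolding G_def \<psi>_def using sec
      by (intro trels.dinatural A.small_Q M.small_Q A.coord_in_phom M.coord_in_phom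
          A.univ_in_sec M.univ_in_sec)
    then have r1: "gen g - G \<psi> \<in> trel_span A M K"
      using sec by (simp add: A.pull_coord_univ M.pull_coord_univ g lspan.base)
    have "G \<psi>' - pscale c (G \<psi>) \<in> trels A M K"
      unfolding G_def \<psi>'_def by (intro trels.scale_hom uten_gen \<psi>)
    then have r2: "G \<psi>' - pscale c (G \<psi>) \<in> trel_span A M K" by (rule lspan.base)
    have "G (\<lambda>j. \<psi>' j + \<chi> j) - G \<psi>' - G \<chi> \<in> trels A M K"
      unfolding G_def by (intro trels.add_hom uten_gen \<psi>' \<chi>)
    then have r3: "G (\<lambda>j. \<psi>' j + \<chi> j) - G \<psi>' - G \<chi> \<in> trel_span A M K" by (rule lspan.base)
    have "pscale c (gen g - G \<psi>) = pscale c (gen g) - pscale c (G \<psi>)"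
      by (rule poly_mapping_eqI) (simp add: lookup_minus right_diff_distrib)
    then have "s (insert g S) - G (\<lambda>j. \<psi>' j + \<chi> j) =
        pscale c (gen g - G \<psi>) + (s S - G \<chi>) - (G \<psi>' - pscale c (G \<psi>)) -
        (G (\<lambda>j. \<psi>' j + \<chi> j) - G \<psi>' - G \<chi>)"
      by (simp add: s)
    also have "\<dots> \<in> trel_span A M K"
      by (rule trel_span_diff[OF trel_span_diff[OF
            trel_span_add[OF trel_span_pscale[OF r1] IH] r2] r3])
    finally show ?case
      using phom_add[OF \<psi>' \<chi>] by (simp add: tc)
  qed
  moreover have "s (Poly_Mapping.keys p) = p"
    using lincomb_unit[of p] by (simp add: s_def lincomb_def)
  ultimately have "tcoord p \<in> phom K (Q \<times> P)" "p - G (tcoord p) \<in> trel_span A M K"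
    using p by (metis finite_keys)+
  then show "tcoord p \<in> phom K (Q \<times> P)" "tclass A M K p = uten K (tcoord p)"
    unfolding ten_def G_def by (simp_all add: tclass_eq)
qed

lemma pull_uten:
  assumes "f \<in> phom K L"
  shows "pull (tensor A M) K L f (uten L \<phi>) = uten K (pcomp \<phi> f)"
  using assms by (simp add: ten_def pull_tensor pull_tfree)

text \<open>The universal tensor lives over a small copy \<open>L\<close> of \<open>Q \<times> P\<close>, so a morphism out of the tensor
  product is a morphism out of \<open>\<Prod>\<^bsub>Q\<times>P\<^esub> k\<close>.\<close>

lemma structure_matrix_exists:
  "\<exists>T \<in> phom (Q \<times> P) P. \<forall>K \<phi>. small K \<and> \<phi> \<in> phom K (Q \<times> P) \<longrightarrow> \<alpha> K (uten K \<phi>) = hM K (pcomp T \<phi>)"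
proof -
  obtain L :: "'u set" and b where L: "small L" and b: "bij_betw b L (Q \<times> P)"
    using small_product[OF infinite_UNIV A.small_Q M.small_Q] .
  define \<beta> :: "('u, 'u \<times> 'u, 'k) pmap" where "\<beta> = reindex b L (Q \<times> P)"
  define \<gamma> :: "('u \<times> 'u, 'u, 'k) pmap" where "\<gamma> = reindex_inv b L"
  have \<beta>: "\<beta> \<in> phom L (Q \<times> P)" unfolding \<beta>_def by (rule reindex_in_phom[OF b])
  have \<gamma>: "\<gamma> \<in> phom (Q \<times> P) L" unfolding \<gamma>_def by (rule reindex_inv_in_phom[OF b])
  define t where "t = M.coord L (\<alpha> L (uten L \<beta>))"
  have uten_sec: "uten L \<beta> \<in> sec (tensor A M) L"
    unfolding sec_tensor ten_def by (intro imageI) (simp add: uten_gen[OF \<beta>])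
  then have "\<alpha> L (uten L \<beta>) \<in> sec M L"
    using morphism L by (simp add: morphism_def)
  then have t: "t \<in> phom L P" "hM L t = \<alpha> L (uten L \<beta>)"
    unfolding t_def using L by (auto simp: M.coord_in_phom M.h_coord)
  have "\<alpha> K (uten K \<phi>) = hM K (pcomp (pcomp t \<gamma>) \<phi>)" if "small K" "\<phi> \<in> phom K (Q \<times> P)" for K \<phi>
  proof -
    have f: "pcomp \<gamma> \<phi> \<in> phom K L" using pcomp_in_phom[OF \<gamma> that(2)] .
    have "pcomp \<beta> (pcomp \<gamma> \<phi>) = \<phi>"
      unfolding pcomp_assoc \<beta>_def \<gamma>_def reindex_reindex_inv[OF b] using that by (simp add: pcomp_pid)
    then have "\<alpha> K (uten K \<phi>) = \<alpha> K (pull (tensor A M) K L (pcomp \<gamma> \<phi>) (uten L \<beta>))"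
      by (simp add: pull_uten[OF f])
    also have "\<dots> = pull M K L (pcomp \<gamma> \<phi>) (\<alpha> L (uten L \<beta>))"
      using morphism that(1) L f uten_sec by (simp add: morphism_def)
    also have "\<dots> = hM K (pcomp t (pcomp \<gamma> \<phi>))"
      using M.pull_h[OF that(1) L f t(1)] t by simp
    finally show ?thesis by (simp add: pcomp_assoc)
  qed
  then show ?thesis using pcomp_in_phom[OF t(1) \<gamma>] by blast
qed

definition structure_matrix :: "('u \<times> 'u, 'u, 'k) pmap"
  where "structure_matrix = (SOME T. T \<in> phom (Q \<times> P) P \<and>
    (\<forall>K \<phi>. small K \<and> \<phi> \<in> phom K (Q \<times> P) \<longrightarrow> \<alpha> K (uten K \<phi>) = hM K (pcomp T \<phi>)))"

lemma structure_matrix: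
  "structure_matrix \<in> phom (Q \<times> P) P"
  "small K \<Longrightarrow> \<phi> \<in> phom K (Q \<times> P) \<Longrightarrow> \<alpha> K (uten K \<phi>) = hM K (pcomp structure_matrix \<phi>)"
proof -
  have "structure_matrix \<in> phom (Q \<times> P) P \<and>
    (\<forall>K \<phi>. small K \<and> \<phi> \<in> phom K (Q \<times> P) \<longrightarrow> \<alpha> K (uten K \<phi>) = hM K (pcomp structure_matrix \<phi>))"
    unfolding structure_matrix_def
    by (rule someI_ex[OF structure_matrix_exists[unfolded Bex_def]])
  then show "structure_matrix \<in> phom (Q \<times> P) P"
    "small K \<Longrightarrow> \<phi> \<in> phom K (Q \<times> P) \<Longrightarrow> \<alpha> K (uten K \<phi>) = hM K (pcomp structure_matrix \<phi>)"
    by blast+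
qed

text \<open>
  The coordinates of the image under \<open>\<alpha>\<close>.  Linearity of \<open>val\<close> is how linearity of \<open>\<alpha>\<close> enters: \<open>\<alpha>\<close> is
  only given as a natural map, but in coordinates it is multiplication by a matrix.
\<close>

definition val :: "(('k, 'u, 'a, 'm) tgen \<Rightarrow>\<^sub>0 'k) \<Rightarrow> ('u, 'u, 'k) pmap"
  where "val p = pcomp structure_matrix (tcoord p)"

lemma val_linear:
  "val (p + q) = (\<lambda>j. val p j + val q j)"
  "val (pscale c p) = (\<lambda>j. pscale c (val p j))"
  by (simp_all add: val_def tcoord_linear pcomp_add_right pcomp_pscale_right)

lemma val_in_phom: "Poly_Mapping.keys p \<subseteq> tgens A M K \<Longrightarrow> val p \<in> phom K P"
  unfolding val_def by (rule pcomp_in_phom[OF structure_matrix(1) tclass_eq_uten(1)])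

lemma action_tclass:
  "small K \<Longrightarrow> Poly_Mapping.keys p \<subseteq> tgens A M K \<Longrightarrow> \<alpha> K (tclass A M K p) = hM K (val p)"
  by (simp add: val_def tclass_eq_uten structure_matrix)

lemma action_ten:
  "small K \<Longrightarrow> (I, J, \<phi>, x, y) \<in> tgens A M K \<Longrightarrow>
    \<alpha> K (ten A M K I J \<phi> x y) = hM K (val (gen (I, J, \<phi>, x, y)))"
  unfolding ten_def by (rule action_tclass) auto

lemma action_ten_in_sec:
  "small K \<Longrightarrow> (I, J, \<phi>, x, y) \<in> tgens A M K \<Longrightarrow> \<alpha> K (ten A M K I J \<phi> x y) \<in> sec M K"
  by (simp add: action_ten M.h_in_sec val_in_phom)

end


lemma coset_eq_image: "coset F N I x = vadd F I x ` N I"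
  by (auto simp: coset_def)

lemma act_ideal_module: "act (ideal_module A S) K t = mult A K (tensor_incl A A K t)"
  by (simp add: ideal_module_def)


section \<open>The canonical map out of the relative tensor product\<close>

text \<open>
  Stated for a presheaf \<open>M\<close> with a map \<open>\<alpha>\<close> rather than for a module record, so that \<open>A\<close> with its
  multiplication is an instance.
\<close>

locale profinite_module = profinite_pairing A Q hA M P hM \<alpha>
  for A :: "('k::field, 'u, 'a) alg" and Q hA
    and M :: "('k, 'u, 'm, 'z) presheaf_scheme" and P hM \<alpha> +
  assumes algebra: "ultrasolid_algebra A"
    and assoc: "\<And>K I1 I2 I3 \<phi> \<psi> L \<phi>' \<psi>' L' x y z.
      assoc_data K I1 I2 I3 \<phi> \<psi> L \<phi>' \<psi>' L' \<Longrightarrow> x \<in> sec A I1 \<Longrightarrow> y \<in> sec A I2 \<Longrightarrow> z \<in> sec M I3 \<Longrightarrow>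
      \<alpha> K (ten A M K L I3 \<phi> (mult A L (ten A A L I1 I2 \<psi> x y)) z) =
      \<alpha> K (ten A M K I1 L' \<phi>' x (\<alpha> L' (ten A M L' I2 I3 \<psi>' y z)))"
begin

lemma mult_commute:
  "small K \<Longrightarrow> (I, J, \<phi>, x, y) \<in> tgens A A K \<Longrightarrow>
    mult A K (ten A A K I J \<phi> x y) = mult A K (ten A A K J I (\<lambda>(j, i). \<phi> (i, j)) y x)"
  by (intro algebra[unfolded ultrasolid_algebra_def, THEN conjunct2, THEN conjunct2,
      THEN conjunct2, THEN conjunct2, THEN conjunct1, rule_format] conjI)

lemma mult_in_sec:
  assumes "small K" "(I, J, \<phi>, x, y) \<in> tgens A A K"
  shows "mult A K (ten A A K I J \<phi> x y) \<in> sec A K"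
proof -
  have "ten A A K I J \<phi> x y \<in> sec (tensor A A) K"
    unfolding sec_tensor ten_def using assms by (intro imageI) simp
  moreover have "morphism (tensor A A) A (mult A)"
    using algebra by (simp add: ultrasolid_algebra_def)
  ultimately show ?thesis
    using assms by (simp add: morphism_def)
qed

text \<open>Associativity and commutativity move a scalar from one factor to the other, so the differences
  that are divided out in the relative tensor product have value zero.\<close>

lemma balancing_val:
  fixes G :: "('k, 'u, 'm, 'a) amod"
  assumes S: "\<And>I. S I \<subseteq> sec A I"
    and G: "subpresheaf G M"
    and G_act: "\<And>K p. act G K (tclass A G K p) = \<alpha> K (tclass A M K p)"
    and t: "t \<in> lspan (tensor (ideal_module A S) G) K (balancing A (ideal_module A S) G K)"
  shows "\<exists>p. t = tclass (ideal_module A S) G K p \<and> Poly_Mapping.keys p \<subseteq> tgens A M K \<and>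
    val p = (\<lambda>_. 0)"
  using t
proof induction
  case zero
  then show ?case
    using val_linear(2)[of 0 0] by (intro exI[of _ 0]) (simp add: vzero_tensor)
next
  case (base t)
  let ?N = "ideal_module A S"
  have N: "subpresheaf ?N A"
    using S by (simp add: subpresheaf_def ideal_module_def)
  obtain I1 I2 I3 \<phi> \<psi> L \<phi>' \<psi>' L' x a z where ad: "assoc_data K I1 I2 I3 \<phi> \<psi> L \<phi>' \<psi>' L'"
    and x: "x \<in> sec ?N I1" and a: "a \<in> sec A I2" and z: "z \<in> sec G I3"
    and t: "t = vadd (tensor ?N G) K
       (ten ?N G K L I3 \<phi> (act ?N L (ten A ?N L I2 I1 (\<lambda>(i2, i1). \<psi> (i1, i2)) a x)) z)
       (vscale (tensor ?N G) K (-1)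
         (ten ?N G K I1 L' \<phi>' x (act G L' (ten A G L' I2 I3 \<psi>' a z))))"
    using base by (auto simp: balancing_def)
  have sm: "small K" "small I1" "small I2" "small I3" "small L" "small L'"
    and ph: "\<phi> \<in> phom K (L \<times> I3)" "\<psi> \<in> phom L (I1 \<times> I2)" "\<phi>' \<in> phom K (I1 \<times> L')"
      "\<psi>' \<in> phom L' (I2 \<times> I3)"
    using ad by (auto simp: assoc_data_def)
  have xA: "x \<in> sec A I1" using x N sm by (auto simp: subpresheaf_def)
  have zM: "z \<in> sec M I3" using z G sm by (auto simp: subpresheaf_def)
  define w where "w = mult A L (ten A A L I1 I2 \<psi> x a)"
  define y where "y = \<alpha> L' (ten A M L' I2 I3 \<psi>' a z)"
  have w: "act ?N L (ten A ?N L I2 I1 (\<lambda>(i2, i1). \<psi> (i1, i2)) a x) = w"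
    unfolding w_def using N sm ph xA a
    by (subst mult_commute) (simp_all add: tgens_def ten_def ideal_module_def tensor_incl_tclass)
  have y: "act G L' (ten A G L' I2 I3 \<psi>' a z) = y"
    unfolding y_def ten_def by (rule G_act)
  have wA: "w \<in> sec A L"
    unfolding w_def using sm ph xA a by (intro mult_in_sec) (simp_all add: tgens_def)
  have yM: "y \<in> sec M L'"
    unfolding y_def using sm ph zM a by (intro action_ten_in_sec) (simp_all add: tgens_def)
  define g1 where "g1 = (L, I3, \<phi>, w, z)"
  define g2 where "g2 = (I1, L', \<phi>', x, y)"
  have g1: "g1 \<in> tgens A M K" unfolding g1_def using sm ph wA zM by (simp add: tgens_def)
  have g2: "g2 \<in> tgens A M K" unfolding g2_def using sm ph xA yM by (simp add: tgens_def)
  have "\<alpha> K (tclass A M K (gen g1)) = \<alpha> K (tclass A M K (gen g2))"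
    using assoc[OF ad xA a zM] by (simp add: ten_def g1_def g2_def w_def y_def)
  then have "hM K (val (gen g1)) = hM K (val (gen g2))"
    using sm g1 g2 by (simp add: action_tclass)
  then have eq: "val (gen g1) = val (gen g2)"
    using sm g1 g2 by (intro M.h_inject[of K]) (simp_all add: val_in_phom)
  define p :: "('k, 'u, 'a, 'm) tgen \<Rightarrow>\<^sub>0 'k" where "p = gen g1 + pscale (- 1) (gen g2)"
  have "t = tclass ?N G K p"
    unfolding t w y by (simp add: ten_def vscale_tensor vadd_tensor p_def g1_def g2_def)
  moreover have "Poly_Mapping.keys p \<subseteq> tgens A M K"
    unfolding p_def using g1 g2 keys_pscale[of "-1" "gen g2"]
    by (intro order.trans[OF keys_add]) auto
  moreover have "val p = (\<lambda>_. 0)"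
    unfolding p_def val_linear by (simp add: eq pscale_minus_one)
  ultimately show ?case by blast
next
  case (add s t)
  then obtain p q where "s = tclass (ideal_module A S) G K p" "t = tclass (ideal_module A S) G K q"
    "Poly_Mapping.keys p \<subseteq> tgens A M K" "Poly_Mapping.keys q \<subseteq> tgens A M K"
    "val p = (\<lambda>_. 0)" "val q = (\<lambda>_. 0)" by blast
  then show ?case
    by (intro exI[of _ "p + q"] conjI order.trans[OF keys_add])
       (auto simp: vadd_tensor val_linear)
next
  case (scale s c)
  then obtain p where "s = tclass (ideal_module A S) G K p"
    "Poly_Mapping.keys p \<subseteq> tgens A M K" "val p = (\<lambda>_. 0)" by blast
  then show ?case
    by (intro exI[of _ "pscale c p"] conjI order.trans[OF keys_pscale])
       (auto simp: vscale_tensor val_linear)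
qed

text \<open>
  The canonical map is defined by choosing the only value that the action takes on a class.  That
  there is only one is the content of \<open>balancing_val\<close>.  It is needed for \<open>M\<close> itself and, with \<open>A\<close> in the
  role of \<open>M\<close>, for the powers of an ideal, whose action is inherited from the multiplication; the
  submodule \<open>G\<close> covers both.
\<close>

lemma canonical_map_image:
  fixes G :: "('k, 'u, 'm, 'a) amod"
  assumes S: "\<And>I. S I \<subseteq> sec A I"
    and G: "subpresheaf G M"
    and G_act: "\<And>K p. act G K (tclass A G K p) = \<alpha> K (tclass A M K p)"
    and K: "small K"
  shows "canonical_map A G K ` sec (rel_tensor A (ideal_module A S) G) K =
    {hM K (val p) | p. Poly_Mapping.keys p \<subseteq> tgens (ideal_module A S) G K}"
proof -
  let ?N = "ideal_module A S"
  let ?B = "\<lambda>K. lspan (tensor ?N G) K (balancing A ?N G K)"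
  have N: "subpresheaf ?N A"
    using S by (simp add: subpresheaf_def ideal_module_def)
  have val: "canonical_map A G K (coset (tensor ?N G) ?B K (tclass ?N G K p)) = hM K (val p)"
    if p: "Poly_Mapping.keys p \<subseteq> tgens ?N G K" for p
  proof -
    have "act G K (tensor_incl A G K (vadd (tensor ?N G) K (tclass ?N G K p) t)) = hM K (val p)"
      if t: "t \<in> ?B K" for t
    proof -
      obtain d where d: "t = tclass ?N G K d" "Poly_Mapping.keys d \<subseteq> tgens A M K" "val d = (\<lambda>_. 0)"
        using balancing_val[OF S G G_act t] by blast
      have "Poly_Mapping.keys (p + d) \<subseteq> tgens A M K"
        using p d tgens_mono[OF N G, of K] by (intro order.trans[OF keys_add]) auto
      then show ?thesis
        using K by (simp add: d vadd_tensor tensor_incl_tclass[OF N] G_act action_tclass val_linear)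
    qed
    moreover have "?B K \<noteq> {}" using lspan.zero by blast
    ultimately have "(\<lambda>t. act G K (tensor_incl A G K t)) `
        (vadd (tensor ?N G) K (tclass ?N G K p) ` ?B K) = {hM K (val p)}"
      unfolding image_image by (simp add: image_constant_conv cong: image_cong_simp)
    then have "(\<lambda>t. act G K (tensor_incl A G K t)) `
        coset (tensor ?N G) ?B K (tclass ?N G K p) = {hM K (val p)}"
      unfolding coset_eq_image[of "tensor ?N G" ?B] .
    then show ?thesis by (simp add: canonical_map_def)
  qed
  have "sec (rel_tensor A ?N G) K =
      (\<lambda>p. coset (tensor ?N G) ?B K (tclass ?N G K p)) ` {p. Poly_Mapping.keys p \<subseteq> tgens ?N G K}"
    by (simp add: rel_tensor_def quot_def sec_tensor image_image)
  then show ?thesis by (auto simp: image_image val)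
qed

end


section \<open>Powers of the augmentation ideal\<close>

declare ideal_power.simps(2) [simp del]

locale profinite_augmented_algebra = profinite_coords A Q hA
  for A :: "('k::field, 'u, 'a) alg" and Q hA +
  fixes \<epsilon> :: "'u set \<Rightarrow> 'a \<Rightarrow> ('u, unit, 'k) pmap"
  assumes infinite_UNIV: "infinite (UNIV :: 'u set)"
    and algebra: "ultrasolid_algebra A"
    and augmentation: "augmentation A \<epsilon>"
begin

sublocale mul: profinite_module A Q hA A Q hA "mult A"
proof
  show "morphism (tensor A A) A (mult A)"
    using algebra by (simp add: ultrasolid_algebra_def)
  fix K I1 I2 I3 L L' x y z and \<phi> \<psi> \<phi>' \<psi>' :: "('u, 'u \<times> 'u, 'k) pmap"
  assume "assoc_data K I1 I2 I3 \<phi> \<psi> L \<phi>' \<psi>' L'" "x \<in> sec A I1" "y \<in> sec A I2" "z \<in> sec A I3"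
  then show "mult A K (ten A A K L I3 \<phi> (mult A L (ten A A L I1 I2 \<psi> x y)) z) =
      mult A K (ten A A K I1 L' \<phi>' x (mult A L' (ten A A L' I2 I3 \<psi>' y z)))"
    by (intro algebra[unfolded ultrasolid_algebra_def, THEN conjunct2, THEN conjunct2,
        THEN conjunct2, THEN conjunct1, rule_format] conjI)
qed (fact infinite_UNIV algebra)+

abbreviation mpow :: "nat \<Rightarrow> 'u set \<Rightarrow> 'a set"
  where "mpow \<equiv> ideal_power A (aug_ideal A \<epsilon>)"

lemma aug_ideal_subset: "aug_ideal A \<epsilon> I \<subseteq> sec A I"
  by (auto simp: aug_ideal_def)

abbreviation mgens :: "nat \<Rightarrow> 'u set \<Rightarrow> ('k, 'u, 'a, 'a) tgen set"
  where "mgens n \<equiv> tgens (ideal_module A (aug_ideal A \<epsilon>)) (ideal_module A (mpow n))"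

text \<open>
  The two parts are proved together: the description of \<open>\<mm>\<^sup>n\<^sup>+\<^sup>1\<close> by formal sums presupposes that \<open>\<mm>\<^sup>n\<close>
  consists of sections of \<open>A\<close>, and implies this for \<open>\<mm>\<^sup>n\<^sup>+\<^sup>1\<close>.
\<close>

lemma mpow_subset_Suc:
  "small K \<Longrightarrow> mpow n K \<subseteq> sec A K \<and>
    mpow (Suc n) K = {hA K (mul.val p) | p. Poly_Mapping.keys p \<subseteq> mgens n K}"
proof (induction n arbitrary: K)
  have step: "mpow (Suc n) K = {hA K (mul.val p) | p. Poly_Mapping.keys p \<subseteq> mgens n K} \<and>
      mpow (Suc n) K \<subseteq> sec A K"
    if sub: "\<And>K. small K \<Longrightarrow> mpow n K \<subseteq> sec A K" and K: "small K" for n K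
  proof -
    have N: "subpresheaf (ideal_module A (aug_ideal A \<epsilon>)) A"
      and G: "subpresheaf (ideal_module A (mpow n)) A"
      using sub aug_ideal_subset by (auto simp: subpresheaf_def ideal_module_def)
    have "act (ideal_module A (mpow n)) K (tclass A (ideal_module A (mpow n)) K p) =
        mult A K (tclass A A K p)" for K p
      by (simp only: act_ideal_module tensor_incl_tclass[OF subpresheaf_refl G])
    from mul.canonical_map_image[OF aug_ideal_subset G this K]
    have eq: "mpow (Suc n) K = {hA K (mul.val p) | p. Poly_Mapping.keys p \<subseteq> mgens n K}"
      by (simp add: ideal_power.simps(2))
    have "hA K (mul.val p) \<in> sec A K" if "Poly_Mapping.keys p \<subseteq> mgens n K" for p
      using that tgens_mono[OF N G] K by (intro h_in_sec mul.val_in_phom) auto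
    then have "mpow (Suc n) K \<subseteq> sec A K" unfolding eq by blast
    with eq show ?thesis by (rule conjI)
  qed
  {
    case 0
    have sub: "mpow 0 K \<subseteq> sec A K" for K by simp
    show ?case by (rule conjI[OF sub step[OF sub 0, THEN conjunct1]])
  next
    case (Suc n)
    have "mpow n K \<subseteq> sec A K" if "small K" for K
      using Suc.IH[OF that] by (rule conjunct1)
    then have sub: "mpow (Suc n) K \<subseteq> sec A K" if "small K" for K
      using step[of n K] that by blast
    show ?case by (rule conjI[OF sub[OF Suc.prems] step[OF sub Suc.prems, THEN conjunct1]])
  }
qed

lemmas mpow_subset = mpow_subset_Suc[THEN conjunct1]
lemmas mpow_Suc = mpow_subset_Suc[THEN conjunct2]

lemma mgens_subset: "mgens n K \<subseteq> tgens A A K"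
  by (rule tgens_mono) (use aug_ideal_subset mpow_subset in \<open>auto simp: subpresheaf_def ideal_module_def\<close>)

lemma mpow_Suc_subset: "small K \<Longrightarrow> mpow (Suc n) K \<subseteq> mpow n K"
proof (induction n arbitrary: K)
  case 0
  then show ?case using mpow_subset[of K "Suc 0"] by simp
next
  case (Suc n)
  have "mgens (Suc n) K \<subseteq> mgens n K"
    using Suc.IH by (intro tgens_mono) (simp_all add: subpresheaf_def ideal_module_def)
  then show ?case
    using Suc.prems unfolding mpow_Suc[OF Suc.prems] by blast
qed

lemma mpow_antimono: "small K \<Longrightarrow> m \<le> n \<Longrightarrow> mpow n K \<subseteq> mpow m K"
  by (rule lift_Suc_antimono_le[of "\<lambda>n. mpow n K", OF mpow_Suc_subset])

lemma mult_in_mpow_Suc: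
  assumes "small K" "small I" "small J" "\<phi> \<in> phom K (I \<times> J)" "x \<in> aug_ideal A \<epsilon> I" "y \<in> mpow n J"
  shows "mult A K (ten A A K I J \<phi> x y) \<in> mpow (Suc n) K"
proof -
  have g: "(I, J, \<phi>, x, y) \<in> mgens n K"
    using assms by (simp add: tgens_def ideal_module_def)
  then have "mult A K (ten A A K I J \<phi> x y) = hA K (mul.val (gen (I, J, \<phi>, x, y)))"
    using assms mgens_subset by (intro mul.action_ten) auto
  then show ?thesis unfolding mpow_Suc[OF assms(1)] using g by auto
qed

text \<open>Closure under the operations comes from adding and scaling formal sums.\<close>

lemma mpow_linear:
  assumes K: "small K" and f: "f \<in> phom K Q" "hA K f \<in> mpow n K"
  shows "g \<in> phom K Q \<Longrightarrow> hA K g \<in> mpow n K \<Longrightarrow> hA K (\<lambda>q. f q + g q) \<in> mpow n K"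
    and "hA K (\<lambda>q. pscale c (f q)) \<in> mpow n K"
proof -
  have val: "\<exists>p. f = mul.val p \<and> Poly_Mapping.keys p \<subseteq> mgens m K"
    if f: "f \<in> phom K Q" "hA K f \<in> mpow (Suc m) K" for f m
  proof -
    obtain p where "hA K f = hA K (mul.val p)" "Poly_Mapping.keys p \<subseteq> mgens m K"
      using f unfolding mpow_Suc[OF K] by blast
    moreover from this have "mul.val p \<in> phom K Q"
      using mgens_subset by (intro mul.val_in_phom) blast
    ultimately show ?thesis using f h_inject[OF K] by blast
  qed
  show "hA K (\<lambda>q. f q + g q) \<in> mpow n K" if g: "g \<in> phom K Q" "hA K g \<in> mpow n K"
  proof (cases n)
    case 0
    then show ?thesis using K f g by (simp add: h_in_sec phom_add)
  next
    case (Suc m)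
    obtain p where p: "f = mul.val p" "Poly_Mapping.keys p \<subseteq> mgens m K"
      using val[OF f[unfolded Suc]] by blast
    moreover obtain q where q: "g = mul.val q" "Poly_Mapping.keys q \<subseteq> mgens m K"
      using val[OF g[unfolded Suc]] by blast
    moreover have "Poly_Mapping.keys (p + q) \<subseteq> mgens m K"
      by (rule order.trans[OF keys_add]) (use p q in auto)
    ultimately show ?thesis
      unfolding Suc mpow_Suc[OF K] by (intro CollectI exI[of _ "p + q"]) (simp add: mul.val_linear)
  qed
  show "hA K (\<lambda>q. pscale c (f q)) \<in> mpow n K"
  proof (cases n)
    case 0
    then show ?thesis using K f by (simp add: h_in_sec phom_pscale)
  next
    case (Suc m)
    obtain p where p: "f = mul.val p" "Poly_Mapping.keys p \<subseteq> mgens m K"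
      using val[OF f[unfolded Suc]] by blast
    then show ?thesis
      using order.trans[OF keys_pscale p(2)]
      unfolding Suc mpow_Suc[OF K] by (intro CollectI exI[of _ "pscale c p"]) (simp add: mul.val_linear)
  qed
qed

lemma mpow_pull:
  assumes I: "small I" and J: "small J" and f: "f \<in> phom I J" and x: "x \<in> mpow n J"
  shows "pull A I J f x \<in> mpow n I"
proof (cases n)
  case 0
  then show ?thesis using assms by (simp add: pull_in_sec)
next
  case (Suc m)
  then obtain p where p: "x = hA J (mul.val p)" "Poly_Mapping.keys p \<subseteq> mgens m J"
    using x unfolding Suc mpow_Suc[OF J] by blast
  define q where "q = pull (tfree A A) I J f p"
  have q: "Poly_Mapping.keys q \<subseteq> mgens m I"
    unfolding q_def pull_tfree
    by (intro order.trans[OF keys_lincomb] UN_least)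
       (auto split: prod.splits intro!: tgens_pcomp[OF f] dest!: subsetD[OF p(2)])
  have "mul.tcoord q = pcomp (mul.tcoord p) f"
  proof
    fix j
    have "mul.tcoord q j = lincomb p (\<lambda>g. lincomb
        (case g of (I, J, \<phi>, x, y) \<Rightarrow> gen (I, J, pcomp \<phi> f, x, y))
        (\<lambda>(I, J, \<phi>, x, y). pcomp (ptens (coord I x) (coord J y)) \<phi> j))"
      unfolding mul.tcoord_def q_def pull_tfree by (rule lincomb_assoc)
    also have "\<dots> = lincomb p (\<lambda>g. lincomb
        (case g of (I, J, \<phi>, x, y) \<Rightarrow> pcomp (ptens (coord I x) (coord J y)) \<phi> j) f)"
      by (intro lincomb_cong) (auto simp: pcomp_eq lincomb_assoc split: prod.splits)
    also have "\<dots> = pcomp (mul.tcoord p) f j"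
      unfolding mul.tcoord_def pcomp_eq by (rule lincomb_assoc[symmetric])
    finally show "mul.tcoord q j = pcomp (mul.tcoord p) f j" .
  qed
  then have "mul.val q = pcomp (mul.val p) f"
    by (simp add: mul.val_def pcomp_assoc)
  moreover have "mul.val p \<in> phom J Q"
    using p mgens_subset by (intro mul.val_in_phom) blast
  ultimately have "pull A I J f x = hA I (mul.val q)"
    using pull_h[OF I J f] by (simp add: p(1))
  then show ?thesis
    unfolding Suc mpow_Suc[OF I] using q by blast
qed

text \<open>The augmentation is a linear form \<open>c\<close> on \<open>\<Prod>\<^sub>Q k\<close>, given by an element of \<open>\<Oplus>\<^sub>Q k\<close>, and \<open>e\<close> is a
  projection onto its kernel.  So \<open>\<mm>\<close> has a universal section too, namely \<open>e\<close>.\<close>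

lemma aug_ideal_projection:
  obtains e where "e \<in> phom Q Q" "hA Q e \<in> aug_ideal A \<epsilon> Q"
    "\<And>I x. small I \<Longrightarrow> x \<in> aug_ideal A \<epsilon> I \<Longrightarrow> pcomp e (coord I x) = coord I x"
proof -
  define c where "c = \<epsilon> Q univ ()"
  have m: "morphism A kunit \<epsilon>" using augmentation by (simp add: augmentation_def)
  have c_keys: "Poly_Mapping.keys c \<subseteq> Q"
    using m univ_in_sec small_Q by (auto simp: morphism_def yoneda_def phom_def c_def)
  have eps: "\<epsilon> I (hA I f) = (\<lambda>_. lincomb c f)" if "small I" "f \<in> phom I Q" for I f
  proof -
    have "\<epsilon> I (hA I f) = \<epsilon> I (pull A I Q f univ)" using that by (simp add: pull_univ)
    also have "\<dots> = pcomp (\<epsilon> Q univ) f"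
      using m that small_Q univ_in_sec by (simp add: morphism_def yoneda_def)
    finally show ?thesis by (auto simp: pcomp_eq c_def)
  qed
  have mem: "hA I f \<in> aug_ideal A \<epsilon> I \<longleftrightarrow> lincomb c f = 0" if "small I" "f \<in> phom I Q" for I f
    using that eps[OF that] by (auto simp: aug_ideal_def h_in_sec yoneda_def fun_eq_iff)
  have mem': "lincomb c (coord I x) = 0" if "small I" "x \<in> aug_ideal A \<epsilon> I" for I x
    using mem[OF that(1) coord_in_phom[OF that(1)], of x] that aug_ideal_subset h_coord by auto
  show thesis
  proof (cases "c = 0")
    case True
    show thesis
    proof (rule that)
      show pid: "(pid Q :: ('u, 'u, 'k) pmap) \<in> phom Q Q" by (simp add: pid_in_phom)
      then show "hA Q (pid Q) \<in> aug_ideal A \<epsilon> Q" by (simp add: mem small_Q True)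
      fix I x assume "small I" "x \<in> aug_ideal A \<epsilon> I"
      then have "coord I x \<in> phom I Q" using aug_ideal_subset by (intro coord_in_phom) auto
      then show "pcomp (pid Q) (coord I x) = coord I x" by (rule pcomp_pid)
    qed
  next
    case False
    then obtain q0 where q0: "Poly_Mapping.lookup c q0 \<noteq> 0"
      by (metis lookup_zero poly_mapping_eqI)
    then have q0_key: "q0 \<in> Poly_Mapping.keys c" by (simp add: in_keys_iff)
    \<comment> \<open>The projection along the coordinate \<open>q0\<close>, which changes only that coordinate.\<close>
    define d where "d = (\<lambda>q. if q = q0 then pscale (- inverse (Poly_Mapping.lookup c q0)) c else 0)"
    define e where "e = (\<lambda>q. pid Q q + d q)"
    have d: "d \<in> phom Q Q"
      using c_keys q0_key order.trans[OF keys_pscale c_keys] by (auto simp: phom_def d_def)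
    have e: "e \<in> phom Q Q" unfolding e_def by (intro phom_add d pid_in_phom) simp
    have "lincomb c d = pscale (Poly_Mapping.lookup c q0) (d q0)"
      using q0_key by (subst lincomb_superset[of "Poly_Mapping.keys c"])
        (auto simp: d_def if_distrib cong: if_cong)
    also have "\<dots> = - c" using q0 by (simp add: d_def pscale_minus_one)
    finally have "lincomb c e = lincomb c (pid Q) - c"
      by (simp add: e_def lincomb_add_right)
    also have "lincomb c (pid Q) = lincomb c (\<lambda>q. Poly_Mapping.single q 1)"
      using c_keys by (intro lincomb_cong) (auto simp: pid_def)
    finally have ce: "lincomb c e = 0" by (simp add: lincomb_unit)
    show thesis
    proof (rule that[OF e])
      show "hA Q e \<in> aug_ideal A \<epsilon> Q" by (simp add: mem small_Q e ce)
      fix I x assume a: "small I" "x \<in> aug_ideal A \<epsilon> I"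
      then have "coord I x \<in> phom I Q" using aug_ideal_subset by (intro coord_in_phom) auto
      moreover have "pcomp d (coord I x) = (\<lambda>_. 0)"
        using mem'[OF a] by (auto simp: pcomp_eq d_def lincomb_pscale)
      ultimately show "pcomp e (coord I x) = coord I x"
        unfolding e_def pcomp_add_left by (simp add: pcomp_pid)
    qed
  qed
qed

end


section \<open>Completeness and vanishing of coordinates\<close>

text \<open>
  Induction on the number of coordinates.  The subspaces of vectors that vanish at the new coordinate
  \<open>q\<close> reach zero by induction, at stage \<open>N\<close> say; then \<open>W N\<close> has dimension at most one, and a
  nonzero vector of \<open>W N\<close> would be proportional to one in each later \<open>W n\<close>, hence lie in all of them.
\<close>

lemma decreasing_subspaces_stabilize:
  fixes W :: "nat \<Rightarrow> ('q \<Rightarrow> 'k::field) set"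
  assumes "finite Q"
    and "\<And>n. W (Suc n) \<subseteq> W n"
    and "\<And>n w q. w \<in> W n \<Longrightarrow> q \<notin> Q \<Longrightarrow> w q = 0"
    and "\<And>n w w' c. w \<in> W n \<Longrightarrow> w' \<in> W n \<Longrightarrow> (\<lambda>q. w q + c * w' q) \<in> W n"
    and "\<And>w. (\<And>n. w \<in> W n) \<Longrightarrow> w = (\<lambda>_. 0)"
  shows "\<exists>N. W N \<subseteq> {\<lambda>_. 0}"
  using assms
proof (induction Q arbitrary: W rule: finite_induct)
  case empty
  then show ?case by (intro exI[of _ 0]) auto
next
  case (insert q Q)
  have anti: "W n \<subseteq> W m" if "m \<le> n" for m n
    using lift_Suc_antimono_le[of W, OF insert.prems(1) that] .
  have "\<exists>N. {w \<in> W N. w q = 0} \<subseteq> {\<lambda>_. 0}"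
  proof (rule insert.IH)
    show "{w \<in> W (Suc n). w q = 0} \<subseteq> {w \<in> W n. w q = 0}" for n
      using insert.prems(1) by blast
    show "w r = 0" if "w \<in> {w \<in> W n. w q = 0}" "r \<notin> Q" for n w r
      using that insert.prems(2)[of w n r] by (cases "r = q") auto
    show "(\<lambda>r. w r + c * w' r) \<in> {w \<in> W n. w q = 0}"
      if "w \<in> {w \<in> W n. w q = 0}" "w' \<in> {w \<in> W n. w q = 0}" for n w w' c
      using that insert.prems(3) by simp
    show "w = (\<lambda>_. 0)" if "\<And>n. w \<in> {w \<in> W n. w q = 0}" for w
      using that by (intro insert.prems(4)) blast
  qed
  then obtain N where N: "\<And>w. w \<in> W N \<Longrightarrow> w q = 0 \<Longrightarrow> w = (\<lambda>_. 0)" by blast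
  show ?case
  proof (rule ccontr)
    assume "\<not> ?thesis"
    then have ne: "\<exists>w\<in>W n. w \<noteq> (\<lambda>_. 0)" for n by blast
    then obtain w where w: "w \<in> W N" "w \<noteq> (\<lambda>_. 0)" by blast
    have "w \<in> W n" for n
    proof (cases "n \<le> N")
      case True
      then show ?thesis using anti w by blast
    next
      case False
      obtain w' where w': "w' \<in> W n" "w' \<noteq> (\<lambda>_. 0)" using ne by blast
      have w'N: "w' \<in> W N" using anti[of N n] False w' by auto
      then have nz: "w' q \<noteq> 0" using N w' by blast
      define s where "s = w q / w' q"
      have "(\<lambda>r. w r + (- s) * w' r) \<in> W N" using insert.prems(3) w w'N by blast
      moreover have "w q + (- s) * w' q = 0" using nz by (simp add: s_def)
      ultimately have "(\<lambda>r. w r + (- s) * w' r) = (\<lambda>_. 0)" using N by blast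
      then have "w = (\<lambda>r. w' r + (s - 1) * w' r)"
        by (simp add: fun_eq_iff algebra_simps)
      then show ?thesis using insert.prems(3)[OF w'(1) w'(1)] by simp
    qed
    then show False using insert.prems(4) w(2) by blast
  qed
qed

text \<open>Its use is to restrict a section to a single index \<open>j\<close>, and to place a section over a point at a
  given index.\<close>

definition emap :: "'i \<Rightarrow> 'j \<Rightarrow> ('i, 'j, 'k::field) pmap"
  where "emap i j = (\<lambda>j'. if j' = j then Poly_Mapping.single i 1 else 0)"

lemma emap_in_phom: "i \<in> I \<Longrightarrow> j \<in> J \<Longrightarrow> emap i j \<in> phom I J"
  by (auto simp: phom_def emap_def)

lemma lincomb_emap: "lincomb c (emap i j) = Poly_Mapping.single i (Poly_Mapping.lookup c j)"
proof -
  have "lincomb c (emap i j) =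
      (\<Sum>q\<in>insert j (Poly_Mapping.keys c). pscale (Poly_Mapping.lookup c q) (emap i j q))"
    by (rule lincomb_superset) auto
  also have "\<dots> = pscale (Poly_Mapping.lookup c j) (Poly_Mapping.single i 1)"
    by (simp add: emap_def if_distrib sum.If_cases cong: if_cong)
  finally show ?thesis by (simp add: pscale_single)
qed

locale complete_profinite_algebra = profinite_augmented_algebra A Q hA \<epsilon>
  for A :: "('k::field, 'u, 'a) alg" and Q hA \<epsilon> +
  assumes complete: "complete A \<epsilon>"
begin

definition mpow_coords :: "nat \<Rightarrow> 'u set \<Rightarrow> ('u, 'u, 'k) pmap set"
  where "mpow_coords n K = {f \<in> phom K Q. hA K f \<in> mpow n K}"

lemma mpow_coords_add: "small K \<Longrightarrow> f \<in> mpow_coords n K \<Longrightarrow> g \<in> mpow_coords n K \<Longrightarrow> (\<lambda>q. f q + g q) \<in> mpow_coords n K"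
  by (simp add: mpow_coords_def mpow_linear phom_add)

lemma mpow_coords_pscale: "small K \<Longrightarrow> f \<in> mpow_coords n K \<Longrightarrow> (\<lambda>q. pscale c (f q)) \<in> mpow_coords n K"
  by (simp add: mpow_coords_def mpow_linear phom_pscale)

lemma mpow_coords_diff: "small K \<Longrightarrow> f \<in> mpow_coords n K \<Longrightarrow> g \<in> mpow_coords n K \<Longrightarrow> (\<lambda>q. f q - g q) \<in> mpow_coords n K"
  using mpow_coords_add[of K f n "\<lambda>q. pscale (- 1) (g q)"] mpow_coords_pscale[of K g n "- 1"]
  by (simp add: pscale_minus_one)

lemma zero_in_D: "small K \<Longrightarrow> (\<lambda>_. 0) \<in> mpow_coords n K"
proof (cases n)
  case 0
  then show "small K \<Longrightarrow> ?thesis" by (simp add: mpow_coords_def h_in_sec)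
next
  case (Suc m)
  have "mul.val 0 = (\<lambda>_. 0)" using mul.val_linear(2)[of 0 0] by simp
  then show "small K \<Longrightarrow> ?thesis"
    unfolding mpow_coords_def Suc by (auto simp: mpow_Suc intro!: exI[of _ 0])
qed

lemma mpow_coords_antimono: "small K \<Longrightarrow> m \<le> n \<Longrightarrow> mpow_coords n K \<subseteq> mpow_coords m K"
  using mpow_antimono by (auto simp: mpow_coords_def)

lemma mpow_coords_pcomp: "small I \<Longrightarrow> small J \<Longrightarrow> f \<in> phom I J \<Longrightarrow> g \<in> mpow_coords n J \<Longrightarrow> pcomp g f \<in> mpow_coords n I"
  using mpow_pull[of I J f "hA J g" n] pcomp_in_phom[of g J Q f I] by (simp add: mpow_coords_def pull_h)

text \<open>Cosets are computed in coordinates, where the additive group laws are available.\<close>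

lemma coset_mpow:
  assumes K: "small K" and f: "f \<in> phom K Q"
  shows "coset A (mpow n) K (hA K f) = (\<lambda>d. hA K (\<lambda>q. f q + d q)) ` mpow_coords n K"
proof -
  have "mpow n K = hA K ` mpow_coords n K"
    using mpow_subset[OF K, of n] h_coord[OF K] coord_in_phom[OF K]
    by (force simp: mpow_coords_def image_iff)
  then have "coset A (mpow n) K (hA K f) = (\<lambda>d. vadd A K (hA K f) (hA K d)) ` mpow_coords n K"
    by (simp add: coset_eq_image image_image)
  also have "\<dots> = (\<lambda>d. hA K (\<lambda>q. f q + d q)) ` mpow_coords n K"
    by (intro image_cong refl vadd_h[OF K f]) (simp add: mpow_coords_def)
  finally show ?thesis .
qed

lemma coset_mpow_eq:
  assumes K: "small K" and f: "f \<in> phom K Q" and g: "g \<in> phom K Q"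
    and fg: "(\<lambda>q. f q - g q) \<in> mpow_coords n K"
  shows "coset A (mpow n) K (hA K f) = coset A (mpow n) K (hA K g)"
proof -
  have sub: "coset A (mpow n) K (hA K f) \<subseteq> coset A (mpow n) K (hA K g)"
    if f: "f \<in> phom K Q" and g: "g \<in> phom K Q" and fg: "(\<lambda>q. f q - g q) \<in> mpow_coords n K" for f g
  proof -
    have "hA K (\<lambda>q. f q + d q) \<in> (\<lambda>d. hA K (\<lambda>q. g q + d q)) ` mpow_coords n K" if "d \<in> mpow_coords n K" for d
      using mpow_coords_add[OF K fg that] by (rule rev_image_eqI) simp
    then show ?thesis unfolding coset_mpow[OF K f] coset_mpow[OF K g] by blast
  qed
  moreover have "(\<lambda>q. g q - f q) \<in> mpow_coords n K"
    using mpow_coords_diff[OF K zero_in_D[OF K] fg] by simp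
  ultimately show ?thesis using f g fg by (meson subset_antisym)
qed

lemma complete_bij:
  assumes "small K"
  shows "bij_betw (\<lambda>x n. coset A (mpow n) K x) (sec A K) (sec (quot_limit A mpow) K)"
  using complete assms by (simp add: complete_def isomorphism_def)

text \<open>Completeness says that \<open>A \<rightarrow> lim A/\<mm>\<^sup>n\<close> is bijective; this is the injective half.\<close>

lemma separated:
  assumes K: "small K" and f: "\<And>n. f \<in> mpow_coords n K"
  shows "f = (\<lambda>_. 0)"
proof -
  have fp: "f \<in> phom K Q" using f[of 0] by (simp add: mpow_coords_def)
  have "coset A (mpow n) K (hA K f) = coset A (mpow n) K (hA K (\<lambda>_. 0))" for n
    using f by (intro coset_mpow_eq[OF K fp]) simp_all
  then have "hA K f = hA K (\<lambda>_. 0)"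
    using bij_betw_imp_inj_on[OF complete_bij[OF K]] h_in_sec[OF K fp] h_in_sec[OF K, of "\<lambda>_. 0"]
    by (auto simp: inj_on_def)
  then show ?thesis using h_inject[OF K fp] by simp
qed

text \<open>The surjective half: partial sums that agree modulo growing powers of \<open>\<mm>\<close> have a limit.\<close>

lemma limit_exists:
  assumes K: "small K" and Y: "\<And>n. Y n \<in> phom K Q"
    and step: "\<And>n. (\<lambda>q. Y (Suc n) q - Y n q) \<in> mpow_coords n K"
  shows "\<exists>z\<in>phom K Q. \<forall>n. (\<lambda>q. z q - Y n q) \<in> mpow_coords n K"
proof -
  define X where "X = (\<lambda>n. coset A (mpow n) K (hA K (Y n)))"
  have "X \<in> sec (quot_limit A mpow) K"
  proof -
    have "X n \<in> sec (quot A (mpow n)) K" for n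
      using h_in_sec[OF K Y] by (auto simp: X_def quot_def)
    moreover have "(\<Union>x\<in>X (Suc n). coset A (mpow n) K x) = X n" for n
    proof (rule SUP_eq_const)
      show "X (Suc n) \<noteq> {}" using zero_in_D[OF K] by (auto simp: X_def coset_mpow[OF K Y])
      fix x assume "x \<in> X (Suc n)"
      then obtain d where d: "d \<in> mpow_coords (Suc n) K" "x = hA K (\<lambda>q. Y (Suc n) q + d q)"
        by (auto simp: X_def coset_mpow[OF K Y])
      then have dn: "d \<in> mpow_coords n K" using mpow_coords_antimono[OF K, of n "Suc n"] by auto
      then have "(\<lambda>q. (Y (Suc n) q + d q) - Y n q) \<in> mpow_coords n K"
        using mpow_coords_add[OF K step dn] by (simp add: algebra_simps)
      then show "coset A (mpow n) K x = X n"
        unfolding d(2) X_def using dn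
        by (intro coset_mpow_eq[OF K _ Y] phom_add Y) (simp_all add: mpow_coords_def)
    qed
    ultimately show ?thesis by (simp add: quot_limit_def)
  qed
  then obtain x where x: "x \<in> sec A K" "X = (\<lambda>n. coset A (mpow n) K x)"
    using bij_betw_imp_surj_on[OF complete_bij[OF K]] by blast
  define z where "z = coord K x"
  have z: "z \<in> phom K Q" "hA K z = x" using x K by (simp_all add: z_def coord_in_phom h_coord)
  have "(\<lambda>q. z q - Y n q) \<in> mpow_coords n K" for n
  proof -
    have "hA K (\<lambda>q. z q + 0) \<in> coset A (mpow n) K (hA K z)"
      unfolding coset_mpow[OF K z(1)] by (intro rev_image_eqI[OF zero_in_D[OF K]]) simp
    then have "hA K z \<in> coset A (mpow n) K (hA K (Y n))"
      using x(2) z(2) by (simp add: X_def fun_eq_iff)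
    then obtain d where d: "d \<in> mpow_coords n K" "hA K z = hA K (\<lambda>q. Y n q + d q)"
      unfolding coset_mpow[OF K Y] by auto
    then have "z = (\<lambda>q. Y n q + d q)"
      using K Y z(1) by (intro h_inject[OF K] phom_add) (simp_all add: mpow_coords_def)
    then show ?thesis using d(1) by simp
  qed
  then show ?thesis using z(1) by blast
qed

text \<open>
  A form of linear compactness.  If there are infinite small index sets, a counterexample is a
  sequence that can be summed to a single section whose coordinate \<open>q\<close> has infinite support;
  otherwise \<open>Q\<close> is finite.
\<close>

lemma mpow_coords_coordinate_vanishes_at_point:
  fixes a :: 'u
  shows "\<exists>N. \<forall>f\<in>mpow_coords N {a}. f q = 0"
proof (rule ccontr)
  assume "\<not> ?thesis"
  then obtain f where f: "\<And>n. f n \<in> mpow_coords n {a}" "\<And>n. f n q \<noteq> 0" by metis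
  have pt: "small {a}" by (rule small_finite[OF infinite_UNIV]) simp
  have coord_pt: "g r = Poly_Mapping.single a (Poly_Mapping.lookup (g r) a)" if "g \<in> mpow_coords n {a}" for g n r
  proof (rule poly_mapping_eqI)
    have "Poly_Mapping.keys (g r) \<subseteq> {a}"
      using that by (cases "r \<in> Q") (auto simp: mpow_coords_def phom_def)
    then show "Poly_Mapping.lookup (g r) i =
        Poly_Mapping.lookup (Poly_Mapping.single a (Poly_Mapping.lookup (g r) a)) i" for i
      by (cases "i = a") (auto simp: lookup_single in_keys_iff)
  qed
  show False
  proof (cases "\<exists>K :: 'u set. small K \<and> infinite K")
    case True
    then obtain K0 :: "'u set" and k :: "nat \<Rightarrow> 'u" where "small K0" "inj k" "range k \<subseteq> K0"
      using infinite_countable_subset by metis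
    define K where "K = range k"
    have K: "small K"
      unfolding K_def using small_subset[OF \<open>range k \<subseteq> K0\<close> \<open>small K0\<close>] .
    have kK: "k n \<in> K" for n by (simp add: K_def)
    \<comment> \<open>The \<open>n\<close>-th section is placed at the index \<open>k n\<close>.\<close>
    define x where "x = (\<lambda>n. pcomp (f n) (emap (k n) a))"
    have x: "x n \<in> mpow_coords n K" for n
      unfolding x_def by (intro mpow_coords_pcomp[OF K pt] f emap_in_phom kK) simp
    define Y where "Y = (\<lambda>n q. \<Sum>m<n. x m q)"
    have Y: "Y n \<in> phom K Q" for n
    proof (induction n)
      case (Suc n)
      then have "(\<lambda>q. Y n q + x n q) \<in> phom K Q"
        using x[of n] by (intro phom_add) (simp_all add: mpow_coords_def)
      then show ?case by (simp add: Y_def)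
    qed (simp add: Y_def)
    have Y_step: "(\<lambda>q. Y (Suc n) q - Y n q) \<in> mpow_coords n K" for n
      using x[of n] by (simp add: Y_def)
    obtain z where z: "z \<in> phom K Q" "\<And>n. (\<lambda>q. z q - Y n q) \<in> mpow_coords n K"
      using limit_exists[where Y = Y, OF K Y Y_step] by auto
    have "k j \<in> Poly_Mapping.keys (z q)" for j
    proof -
      \<comment> \<open>The restriction of the limit to \<open>k j\<close> is \<open>f j\<close>: the terms of index above \<open>j\<close> restrict to zero.\<close>
      define g where "g = pcomp z (emap a (k j))"
      have em: "emap a (k j) \<in> phom {a} K" by (intro emap_in_phom kK) simp
      have xj: "pcomp (x m) (emap a (k j)) r = (if m = j then f j r else 0)" for m r
        using inj_eq[OF \<open>inj k\<close>]
        by (simp add: x_def pcomp_eq lincomb_emap lookup_single when_def flip: coord_pt[OF f(1)])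
      have big: "(\<lambda>r. g r - f j r) \<in> mpow_coords n {a}" if "j < n" for n
      proof -
        have "pcomp (\<lambda>r. z r - Y n r) (emap a (k j)) r = g r - f j r" for r
        proof -
          have "lincomb (Y n r) (emap a (k j)) = (\<Sum>m<n. if m = j then f j r else 0)"
            using xj by (simp add: Y_def lincomb_sum pcomp_eq)
          then show ?thesis
            using that by (simp add: pcomp_eq lincomb_minus g_def)
        qed
        then have "pcomp (\<lambda>r. z r - Y n r) (emap a (k j)) = (\<lambda>r. g r - f j r)" by blast
        then show ?thesis using mpow_coords_pcomp[OF pt K em z(2)[of n]] by simp
      qed
      have "(\<lambda>r. g r - f j r) \<in> mpow_coords n {a}" for n
        using big[of "max n (Suc j)"] mpow_coords_antimono[OF pt, of n "max n (Suc j)"] by auto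
      then have "(\<lambda>r. g r - f j r) = (\<lambda>_. 0)" by (rule separated[OF pt])
      then have "g q = f j q" by (simp add: fun_eq_iff)
      then have "Poly_Mapping.single a (Poly_Mapping.lookup (z q) (k j)) \<noteq> 0"
        using f(2)[of j] by (simp add: g_def pcomp_eq lincomb_emap)
      then show ?thesis by (auto simp: in_keys_iff)
    qed
    then have "range k \<subseteq> Poly_Mapping.keys (z q)" by blast
    then have "finite (range k)" using finite_keys finite_subset by blast
    then show False using \<open>inj k\<close> finite_imageD by blast
  next
    case False
    then have fin: "finite Q" using small_Q by blast
    define W where "W = (\<lambda>n. (\<lambda>g r. Poly_Mapping.lookup (g r) a) ` mpow_coords n {a})"
    have "\<exists>N. W N \<subseteq> {\<lambda>_. 0}"
    proof (rule decreasing_subspaces_stabilize[OF fin])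
      show "W (Suc n) \<subseteq> W n" for n
        unfolding W_def by (intro image_mono mpow_coords_antimono[OF pt]) simp
      show "w r = 0" if "w \<in> W n" "r \<notin> Q" for n w r
        using that by (auto simp: W_def mpow_coords_def phom_def)
      show "(\<lambda>r. w r + c * w' r) \<in> W n" if w: "w \<in> W n" "w' \<in> W n" for n w w' c
      proof -
        obtain g g' where g: "g \<in> mpow_coords n {a}" "g' \<in> mpow_coords n {a}"
          "w = (\<lambda>r. Poly_Mapping.lookup (g r) a)" "w' = (\<lambda>r. Poly_Mapping.lookup (g' r) a)"
          using w by (auto simp: W_def)
        show ?thesis
          unfolding W_def
          by (rule rev_image_eqI[OF mpow_coords_add[OF pt g(1) mpow_coords_pscale[OF pt g(2), of c]]])
             (simp add: g lookup_add)
      qed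
      show "w = (\<lambda>_. 0)" if w: "\<And>n. w \<in> W n" for w
      proof -
        define g where "g = (\<lambda>r. Poly_Mapping.single a (w r))"
        have "g \<in> mpow_coords n {a}" for n
        proof -
          obtain g' where g': "g' \<in> mpow_coords n {a}" "w = (\<lambda>r. Poly_Mapping.lookup (g' r) a)"
            using w[of n] by (auto simp: W_def)
          then have "g = g'" using coord_pt[OF g'(1)] by (simp add: g_def fun_eq_iff)
          then show ?thesis using g' by simp
        qed
        then have "g = (\<lambda>_. 0)" by (rule separated[OF pt])
        then have "Poly_Mapping.lookup (g r) a = 0" for r by simp
        then show ?thesis by (simp add: g_def fun_eq_iff)
      qed
    qed
    then obtain N where "W N \<subseteq> {\<lambda>_. 0}" ..
    then have "(\<lambda>r. Poly_Mapping.lookup (f N r) a) = (\<lambda>_. 0)"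
      using f(1)[of N] unfolding W_def by blast
    then have "Poly_Mapping.lookup (f N q) a = 0" by (rule fun_cong)
    then show False using coord_pt[OF f(1), of N q] f(2)[of N] by simp
  qed
qed

text \<open>A nonzero coordinate of a section over \<open>I\<close> stays nonzero at some index \<open>i \<in> I\<close>, so the bound found
  over a point is valid over every \<open>I\<close>.\<close>

lemma mpow_coordinates_vanish:
  assumes "finite S"
  shows "\<exists>N. \<forall>I x q. small I \<and> x \<in> mpow N I \<and> q \<in> S \<longrightarrow> coord I x q = 0"
proof -
  define a :: 'u where "a = undefined"
  have pt: "small {a}" by (rule small_finite[OF infinite_UNIV]) simp
  obtain N where N: "\<And>q f. f \<in> mpow_coords (N q) {a} \<Longrightarrow> f q = 0"
    using mpow_coords_coordinate_vanishes_at_point[of a] by metis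
  have "coord I x q = 0" if I: "small I" and x: "x \<in> mpow (Max (N ` S)) I" and q: "q \<in> S" for I x q
  proof (rule poly_mapping_eqI)
    fix i
    have le: "N q \<le> Max (N ` S)" using assms q by simp
    have xI: "x \<in> sec A I" using x mpow_subset[OF I] by blast
    then have cI: "coord I x \<in> phom I Q" by (rule coord_in_phom[OF I])
    have "coord I x \<in> mpow_coords (N q) I"
      using mpow_antimono[OF I le] x cI h_coord[OF I xI] by (auto simp: mpow_coords_def)
    show "Poly_Mapping.lookup (coord I x q) i = Poly_Mapping.lookup 0 i"
    proof (cases "i \<in> I")
      case True
      have "pcomp (coord I x) (emap a i) \<in> mpow_coords (N q) {a}"
        using True by (intro mpow_coords_pcomp[OF pt I] emap_in_phom \<open>coord I x \<in> mpow_coords (N q) I\<close>) simp_all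
      then have "Poly_Mapping.single a (Poly_Mapping.lookup (coord I x q) i) = 0"
        using N by (fastforce simp: pcomp_eq lincomb_emap)
      then have "Poly_Mapping.lookup (Poly_Mapping.single a (Poly_Mapping.lookup (coord I x q) i)) a = 0"
        by (metis lookup_zero)
      then show ?thesis by simp
    next
      case False
      then have "i \<notin> Poly_Mapping.keys (coord I x q)"
        using cI by (cases "q \<in> Q") (auto simp: phom_def)
      then show ?thesis by (simp add: in_keys_iff)
    qed
  qed
  then show ?thesis by blast
qed

end


section \<open>Iterating the fixed-point equation\<close>

context complete_profinite_algebra
begin

text \<open>
  A preimage of \<open>u\<close> is a formal sum with first entries in \<open>\<mm>\<close>.  All of these are pullbacks of
  the projection \<open>e\<close> onto \<open>\<mm>\<close>, so the sum collapses to a single pure tensor \<open>e \<otimes> u\<close>.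
\<close>

lemma universal_section_fixed:
  fixes M :: "('k, 'u, 'm, 'a) amod"
  assumes "profinite_module A Q hA M P hM (act M)"
    and surj: "\<And>K. small K \<Longrightarrow> sec M K \<subseteq>
      canonical_map A M K ` sec (rel_tensor A (ideal_module A (aug_ideal A \<epsilon>)) M) K"
  obtains \<phi> v where "\<phi> \<in> phom P (Q \<times> P)" "v \<in> aug_ideal A \<epsilon> Q"
    "act M P (ten A M P Q P \<phi> v (profinite_coords.univ P hM)) = profinite_coords.univ P hM"
proof -
  interpret N: profinite_module A Q hA M P hM "act M" by fact
  let ?N = "ideal_module A (aug_ideal A \<epsilon>)"
  have P: "small P" by (rule N.M.small_Q)
  have N: "subpresheaf ?N A"
    using aug_ideal_subset by (simp add: subpresheaf_def ideal_module_def)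
  obtain p where p: "N.M.univ = hM P (N.val p)" "Poly_Mapping.keys p \<subseteq> tgens ?N M P"
    using surj[OF P] N.M.univ_in_sec N.canonical_map_image[OF aug_ideal_subset subpresheaf_refl refl P]
    by blast
  have pA: "Poly_Mapping.keys p \<subseteq> tgens A M P"
    using p tgens_mono[OF N subpresheaf_refl, of M P] by blast
  define \<phi> where "\<phi> = N.tcoord p"
  have \<phi>: "\<phi> \<in> phom P (Q \<times> P)" unfolding \<phi>_def by (rule N.tclass_eq_uten(1)[OF pA])
  obtain e where e: "e \<in> phom Q Q" "hA Q e \<in> aug_ideal A \<epsilon> Q"
    and fix_e: "\<And>I x. small I \<Longrightarrow> x \<in> aug_ideal A \<epsilon> I \<Longrightarrow> pcomp e (coord I x) = coord I x"
    using aug_ideal_projection by blast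
  have "pcomp (ptens e (pid P)) \<phi> = \<phi>"
  proof
    fix j
    have "pcomp (ptens e (pid P)) \<phi> j = lincomb p (\<lambda>g. lincomb (ptens e (pid P) j)
        (\<lambda>i. case g of (I, J, \<psi>, x, y) \<Rightarrow> pcomp (ptens (coord I x) (N.M.coord J y)) \<psi> i))"
      unfolding pcomp_eq \<phi>_def N.tcoord_def by (rule lincomb_swap)
    also have "\<dots> = lincomb p
        (\<lambda>(I, J, \<psi>, x, y). pcomp (ptens (coord I x) (N.M.coord J y)) \<psi> j)"
    proof (rule lincomb_cong)
      fix g assume "g \<in> Poly_Mapping.keys p"
      then obtain I J \<psi> x y where g: "g = (I, J, \<psi>, x, y)" "small I" "small J"
        "x \<in> aug_ideal A \<epsilon> I" "y \<in> sec M J"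
        using p(2) by (auto simp: tgens_def ideal_module_def)
      have "pcomp (ptens e (pid P)) (pcomp (ptens (coord I x) (N.M.coord J y)) \<psi>) =
          pcomp (ptens (coord I x) (N.M.coord J y)) \<psi>"
        using g fix_e N.M.coord_in_phom[of J y] by (simp add: pcomp_assoc flip: ptens_pcomp)
          (simp add: pcomp_pid)
      then have "pcomp (ptens e (pid P)) (pcomp (ptens (coord I x) (N.M.coord J y)) \<psi>) j =
          pcomp (ptens (coord I x) (N.M.coord J y)) \<psi> j"
        by (rule fun_cong)
      then show "lincomb (ptens e (pid P) j)
          (\<lambda>i. case g of (I, J, \<psi>, x, y) \<Rightarrow> pcomp (ptens (coord I x) (N.M.coord J y)) \<psi> i) =
          (case g of (I, J, \<psi>, x, y) \<Rightarrow> pcomp (ptens (coord I x) (N.M.coord J y)) \<psi> j)"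
        by (simp add: g pcomp_eq)
    qed
    finally show "pcomp (ptens e (pid P)) \<phi> j = \<phi> j"
      by (simp add: \<phi>_def N.tcoord_def)
  qed
  then have "N.val (gen (Q, P, \<phi>, hA Q e, N.M.univ)) = N.val p"
    using e by (simp add: N.val_def coord_h small_Q N.M.coord_univ \<phi>_def)
  moreover have "(Q, P, \<phi>, hA Q e, N.M.univ) \<in> tgens A M P"
    using \<phi> e small_Q P h_in_sec N.M.univ_in_sec by (simp add: tgens_def)
  ultimately have "act M P (ten A M P Q P \<phi> (hA Q e) N.M.univ) = N.M.univ"
    using p P by (simp add: N.action_ten)
  then show thesis using that \<phi> e by blast
qed

text \<open>
  From \<open>u = v \<cdot> u\<close> and \<open>u = x \<cdot> u\<close> follows \<open>u = v \<cdot> (x \<cdot> u) = (v x) \<cdot> u\<close>, and \<open>v x\<close> lies in \<open>\<mm>\<^sup>n\<^sup>+\<^sup>1\<close>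
  when \<open>x\<close> lies in \<open>\<mm>\<^sup>n\<close>; the induction starts with \<open>x = v\<close> in \<open>\<mm>\<^sup>0 = A\<close>.  The product \<open>v x\<close> is formed over a small copy \<open>L\<close> of \<open>Q \<times> I\<close>.
\<close>

lemma universal_section_in_mpow:
  fixes M :: "('k, 'u, 'm, 'a) amod"
  assumes "profinite_module A Q hA M P hM (act M)"
    and surj: "\<And>K. small K \<Longrightarrow> sec M K \<subseteq>
      canonical_map A M K ` sec (rel_tensor A (ideal_module A (aug_ideal A \<epsilon>)) M) K"
  shows "\<exists>I \<phi> x. small I \<and> \<phi> \<in> phom P (I \<times> P) \<and> x \<in> mpow n I \<and>
    act M P (ten A M P I P \<phi> x (profinite_coords.univ P hM)) = profinite_coords.univ P hM"
proof -
  interpret N: profinite_module A Q hA M P hM "act M" by fact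
  have P: "small P" by (rule N.M.small_Q)
  obtain \<phi> v where \<phi>: "\<phi> \<in> phom P (Q \<times> P)" and v: "v \<in> aug_ideal A \<epsilon> Q"
    and fp: "act M P (ten A M P Q P \<phi> v N.M.univ) = N.M.univ"
    using universal_section_fixed[OF assms] by blast
  have vA: "v \<in> sec A Q" using v aug_ideal_subset by blast
  show ?thesis
  proof (induction n)
    case 0
    then show ?case using \<phi> vA fp small_Q by auto
  next
    case (Suc n)
    then obtain I \<psi>' x where I: "small I" and \<psi>': "\<psi>' \<in> phom P (I \<times> P)" and x: "x \<in> mpow n I"
      and IH: "act M P (ten A M P I P \<psi>' x N.M.univ) = N.M.univ" by blast
    obtain L :: "'u set" and b where L: "small L" and b: "bij_betw b L (Q \<times> I)"
      using small_product[OF infinite_UNIV small_Q I] .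
    define \<psi> :: "('u, 'u \<times> 'u, 'k) pmap" where "\<psi> = reindex b L (Q \<times> I)"
    have \<psi>: "\<psi> \<in> phom L (Q \<times> I)" unfolding \<psi>_def by (rule reindex_in_phom[OF b])
    \<comment> \<open>\<open>\<theta>\<close> is the composite along which \<open>v \<otimes> (x \<otimes> u)\<close> is pulled back, and \<open>\<phi>'\<close> is \<open>\<theta>\<close> with \<open>Q \<times> I\<close>
      replaced by \<open>L\<close>, along which \<open>v x \<otimes> u\<close> is pulled back.\<close>
    define \<theta> where "\<theta> = pcomp (ptens (pid Q) \<psi>') \<phi>"
    have "ptens (pid Q) \<psi>' \<in> phom (Q \<times> P) (Q \<times> (I \<times> P))"
      by (intro ptens_in_phom pid_in_phom \<psi>') simp
    then have \<theta>: "\<theta> \<in> phom P (Q \<times> (I \<times> P))"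
      unfolding \<theta>_def using \<phi> by (rule pcomp_in_phom)
    define \<phi>' where "\<phi>' = (\<lambda>(l, i3). if l \<in> L \<and> i3 \<in> P then \<theta> (fst (b l), (snd (b l), i3)) else 0)"
    have \<phi>': "\<phi>' \<in> phom P (L \<times> P)"
      unfolding phom_def
    proof (intro CollectI conjI ballI allI impI)
      fix j assume j: "j \<in> L \<times> P"
      have "b (fst j) \<in> Q \<times> I" using j bij_betwE[OF b] by (simp add: mem_Times_iff)
      then have "(fst (b (fst j)), (snd (b (fst j)), snd j)) \<in> Q \<times> (I \<times> P)"
        using j by (simp add: mem_Times_iff)
      then have "Poly_Mapping.keys (\<theta> (fst (b (fst j)), (snd (b (fst j)), snd j))) \<subseteq> P"
        using \<theta> unfolding phom_def by blast
      then show "Poly_Mapping.keys (\<phi>' j) \<subseteq> P"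
        using j by (cases j) (simp add: \<phi>'_def)
    qed (auto simp: \<phi>'_def split: if_splits)
    have "assoc_data P Q I P \<phi>' \<psi> L \<phi> \<psi>' P"
      unfolding assoc_data_def
    proof (intro conjI allI)
      fix i1 i2 i3
      show "pcomp (ptens \<psi> (pid P)) \<phi>' ((i1, i2), i3) = pcomp (ptens (pid Q) \<psi>') \<phi> (i1, (i2, i3))"
      proof (cases "(i1, i2) \<in> Q \<times> I \<and> i3 \<in> P")
        case True
        define l where "l = inv_into L b (i1, i2)"
        have l: "l \<in> L" "b l = (i1, i2)"
          using True b by (auto simp: l_def bij_betw_def inv_into_into f_inv_into_f)
        have "ptens \<psi> (pid P) ((i1, i2), i3) = Poly_Mapping.single (l, i3) (1 :: 'k)"
          using True by (simp add: ptens_eq \<psi>_def reindex_def pid_def l_def)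
        then show ?thesis
          using True l by (simp add: pcomp_eq[of "ptens \<psi> (pid P)"] \<phi>'_def \<theta>_def)
      next
        case False
        then have "(i1, (i2, i3)) \<notin> Q \<times> (I \<times> P)" by auto
        then have "\<theta> (i1, (i2, i3)) = 0" using \<theta> unfolding phom_def by blast
        moreover have "ptens \<psi> (pid P) ((i1, i2), i3) = 0"
          using False by (auto simp: ptens_eq \<psi>_def reindex_def pid_def)
        ultimately show ?thesis by (simp add: pcomp_eq[of "ptens \<psi> (pid P)"] \<theta>_def)
      qed
    qed (fact P small_Q I L \<phi>' \<psi> \<phi> \<psi>')+
    moreover have "x \<in> sec A I" using x mpow_subset[OF I] by blast
    ultimately have "act M P (ten A M P L P \<phi>' (mult A L (ten A A L Q I \<psi> v x)) N.M.univ) =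
        act M P (ten A M P Q P \<phi> v (act M P (ten A M P I P \<psi>' x N.M.univ)))"
      using vA N.M.univ_in_sec by (intro N.assoc)
    then have "act M P (ten A M P L P \<phi>' (mult A L (ten A A L Q I \<psi> v x)) N.M.univ) = N.M.univ"
      by (simp add: IH fp)
    moreover have "mult A L (ten A A L Q I \<psi> v x) \<in> mpow (Suc n) L"
      by (rule mult_in_mpow_Suc[OF L small_Q I \<psi> v x])
    ultimately show ?case using L \<phi>' by blast
  qed
qed

text \<open>
  Row \<open>r\<close> of the structure matrix meets finitely many coordinates \<open>q\<close> of \<open>A\<close>.  For \<open>x\<close> in a power of
  \<open>\<mm>\<close> on which all of them vanish, the coordinate \<open>r\<close> of \<open>x \<cdot> u = u\<close> is zero, although \<open>u\<close> is the identity.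
\<close>

lemma module_index_set_empty:
  fixes M :: "('k, 'u, 'm, 'a) amod"
  assumes "profinite_module A Q hA M P hM (act M)"
    and surj: "\<And>K. small K \<Longrightarrow> sec M K \<subseteq>
      canonical_map A M K ` sec (rel_tensor A (ideal_module A (aug_ideal A \<epsilon>)) M) K"
  shows "P = {}"
proof (rule ccontr)
  interpret N: profinite_module A Q hA M P hM "act M" by fact
  have P: "small P" by (rule N.M.small_Q)
  assume "P \<noteq> {}"
  then obtain r where r: "r \<in> P" by blast
  let ?T = "N.structure_matrix"
  obtain n where n: "\<And>I x q. small I \<Longrightarrow> x \<in> mpow n I \<Longrightarrow> q \<in> fst ` Poly_Mapping.keys (?T r) \<Longrightarrow>
      coord I x q = 0"
    using mpow_coordinates_vanish[of "fst ` Poly_Mapping.keys (?T r)"] by (meson finite_imageI finite_keys)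
  obtain I \<phi> x where I: "small I" and \<phi>: "\<phi> \<in> phom P (I \<times> P)" and x: "x \<in> mpow n I"
    and fp: "act M P (ten A M P I P \<phi> x N.M.univ) = N.M.univ"
    using universal_section_in_mpow[OF assms, of n] by blast
  have g: "(I, P, \<phi>, x, N.M.univ) \<in> tgens A M P"
    using I P \<phi> x mpow_subset[OF I] N.M.univ_in_sec by (auto simp: tgens_def)
  have "N.M.univ = hM P (N.val (gen (I, P, \<phi>, x, N.M.univ)))"
    using fp N.action_ten[OF P g] by simp
  then have "pid P = N.val (gen (I, P, \<phi>, x, N.M.univ))"
    using P g by (intro N.M.h_inject[OF P] N.val_in_phom) (simp_all add: pid_in_phom N.M.univ_def)
  also have "\<dots> = pcomp ?T (pcomp (ptens (coord I x) (pid P)) \<phi>)"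
    by (simp add: N.val_def N.M.coord_univ)
  finally have eq: "pid P = pcomp ?T (pcomp (ptens (coord I x) (pid P)) \<phi>)" .
  have "Poly_Mapping.single r 1 = pid P r"
    using r by (simp add: pid_def)
  also have "\<dots> = pcomp ?T (pcomp (ptens (coord I x) (pid P)) \<phi>) r"
    by (rule fun_cong[OF eq])
  also have "\<dots> = lincomb (?T r) (\<lambda>_. 0)"
    unfolding pcomp_eq[of ?T]
  proof (rule lincomb_cong)
    fix j assume j: "j \<in> Poly_Mapping.keys (?T r)"
    then have "coord I x (fst j) = 0" using n[OF I x] by blast
    then show "pcomp (ptens (coord I x) (pid P)) \<phi> j = 0"
      by (cases j) (simp add: pcomp_eq ptens_eq)
  qed
  finally have "Poly_Mapping.lookup (Poly_Mapping.single r (1 :: 'k)) r = 0" by simp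
  then show False by simp
qed

end

section \<open>Nakayama's lemma for profinite modules\<close>

theorem proposition3p21:
  fixes A :: "('k::field, 'u, 'a) alg"
    and \<epsilon> :: "'u set \<Rightarrow> 'a \<Rightarrow> ('u, unit, 'k) pmap"
    and M :: "('k, 'u, 'm, 'a) amod"
  assumes "infinite (UNIV :: 'u set)"
    and "ultrasolid_algebra A" and "augmentation A \<epsilon>"
    and "complete A \<epsilon>" and "profinite A"
    and "ultrasolid_module A M" and "profinite M"
    and "isomorphism (rel_tensor A (ideal_module A (aug_ideal A \<epsilon>)) M) M (canonical_map A M)"
  shows "is_zero M"
proof -
  obtain Q :: "'u set" and hA where A: "small Q" "isomorphism (yoneda Q) A hA"
    using \<open>profinite A\<close> unfolding profinite_def by blast
  obtain P :: "'u set" and hM where M: "small P" "isomorphism (yoneda P) M hM"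
    using \<open>profinite M\<close> unfolding profinite_def by blast
  have A': "ultrasolid A" using assms(2) by (simp add: ultrasolid_algebra_def)
  have M': "ultrasolid M" "morphism (tensor A M) M (act M)"
    using assms(6) by (simp_all add: ultrasolid_module_def)
  interpret complete_profinite_algebra A Q hA \<epsilon>
    by unfold_locales (fact A A' assms)+
  interpret M: profinite_coords M P hM
    by unfold_locales (fact M M')+
  have "profinite_module A Q hA M P hM (act M)"
  proof
    fix K I1 I2 I3 L L' x y z and \<phi> \<psi> \<phi>' \<psi>' :: "('u, 'u \<times> 'u, 'k) pmap"
    assume "assoc_data K I1 I2 I3 \<phi> \<psi> L \<phi>' \<psi>' L'" "x \<in> sec A I1" "y \<in> sec A I2" "z \<in> sec M I3"
    then show "act M K (ten A M K L I3 \<phi> (mult A L (ten A A L I1 I2 \<psi> x y)) z) =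
        act M K (ten A M K I1 L' \<phi>' x (act M L' (ten A M L' I2 I3 \<psi>' y z)))"
      by (intro assms(6)[unfolded ultrasolid_module_def, THEN conjunct2, THEN conjunct2,
          THEN conjunct1, rule_format] conjI)
  qed (fact assms M M')+
  moreover have "sec M K \<subseteq>
      canonical_map A M K ` sec (rel_tensor A (ideal_module A (aug_ideal A \<epsilon>)) M) K"
    if "small K" for K
    using assms(8) that by (simp add: isomorphism_def bij_betw_def)
  ultimately have "P = {}" by (rule module_index_set_empty)
  show ?thesis
    unfolding is_zero_def
  proof (intro allI impI)
    fix I :: "'u set" assume I: "small I"
    have "phom I P = {\<lambda>_. 0 :: 'u \<Rightarrow>\<^sub>0 'k}"
      using \<open>P = {}\<close> by (auto simp: phom_def)
    then show "sec M I = {vzero M I}"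
      using M.bij_h[OF I] M.vzero_h[OF I] by (simp add: bij_betw_def)
  qed
qed

end
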